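(* Let $\Omega\subset\mathbb{R}^3$ be a bounded domain with $C^1$ convex boundary $\partial\Omega$. Suppose that the emission-absorption coefficient $\alpha_\nu>0$ depends only on the radiation frequency $\nu\in(0,\infty)$. Consider the stationary radiative transfer equation with emission-absorption only $$n\cdot\nabla_x I_\nu(x,n)=\alpha_\nu\,(B_\nu(T(x))-I_\nu(x,n)),\qquad x\in\Omega,\ n\in\mathbb{S}^2,\ \nu>0,$$ coupled with the conservation law $$\nabla_x\cdot\mathcal{F}(x)=0 \ \text{ in }\Omega,\qquad \mathcal{F}(x)=\int_0^\infty d\nu\int_{\mathbb{S}^2} n\,I_\nu(x,n)\,dn,$$ and the incoming boundary condition $$I_\nu(x,n)=g_\nu(n)\ge 0\quad\text{for }x\in\partial\Omega,\ n\in\mathbb{S}^2,\ n\cdot n_x<0,\qquad \int_{\mathbb{S}^2}\int_0^\infty g_\nu(n)\,d\nu\,dn<+\infty .$$ Suppose further that $\int_0^\infty\alpha_\nu\,d\nu<+\infty$ and that $\alpha_\nu^2 g_\nu(n)\in L^1([0,\infty)_\nu\times\mathbb{S}^2_n)$. Define $$f(T(x))=\int_0^\infty\alpha_\nu B_\nu(T(x))\,d\nu .$$ Then the system admits a solution of the local temperature distribution $T$ with $f(T)\in L^\infty_{\ge 0}(\Omega)$. Moreover, the solution $f(T)\in L^\infty_{\ge0}(\Omega)$ is unique.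
   Context: $B_\nu(T)=\frac{2h\nu^3}{c^2}\frac{1}{e^{h\nu/(kT)}-1}$ is the Planck (black-body) emission (with $B_\nu(0)=0$), with $h,c,k>0$ physical constants. $I_\nu(x,n)$ is the intensity of radiation of frequency $\nu$ at $x$ in direction $n$; $n_x$ is the outward unit normal at $x\in\partial\Omega$. $L^\infty_{\ge0}(\Omega)$ is the space of non-negative $L^\infty$ functions on $\Omega$. For $(x,n)\in\Omega\times\mathbb{S}^2$, let $y(x,n)\in\partial\Omega$ be the point where the backward ray from $x$ in direction $-n$ meets $\partial\Omega$ and $s(x,n)=|x-y(x,n)|$. Given $T$, the intensity is obtained by integrating the transport equation along rays: $$I_\nu(x,n)=g_\nu(n)e^{-\alpha_\nu s(x,n)}+\alpha_\nu\int_0^{s(x,n)}e^{-\alpha_\nu(s(x,n)-\xi)}B_\nu(T(y(x,n)+\xi n))\,d\xi .$$ $T$ is a solution if the flux $\mathcal{F}$ of this $I_\nu$ is divergence-free in $\Omega$ (in the sense of distributions). *)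

theory Defs
  imports "HOL-Analysis.Analysis"
begin

section \<open>Surface measure on the unit sphere and frequency measure\<close>

text \<open>
  The surface measure of a Borel set \<open>A\<close> of the unit sphere in three-dimensional space is three
  times the volume of the cone of all \<open>r n\<close> with \<open>0 < r < 1\<close> and \<open>n\<close> in \<open>A\<close>; this
  is the measure of the polar-coordinate formula, and its total mass is \<open>4 \<pi>\<close>.
\<close>

definition sphere_surface :: "(real ^ 3) measure" where
  "sphere_surface =
     scale_measure 3
       (distr (restrict_space lborel (ball 0 1 - {0}))
              (restrict_space borel (sphere 0 1))
              (\<lambda>x. x /\<^sub>R norm x))"

abbreviation freq :: "real measure" where
  "freq \<equiv> restrict_space lborel {0<..}"


section \<open>Domains with $C^1$ boundary\<close>

text \<open>
  Locally the domain is the sublevel set of a $C^1$ function with nonvanishing gradient (so that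
  the outward unit normal at a boundary point is the normalised gradient).
\<close>

definition C1_boundary :: "(real ^ 3) set \<Rightarrow> bool" where
  "C1_boundary \<Omega> \<longleftrightarrow>
     (\<forall>p\<in>frontier \<Omega>. \<exists>U \<phi> G. open U \<and> p \<in> U \<and>
        (\<forall>x\<in>U. GDERIV \<phi> x :> G x \<and> G x \<noteq> 0) \<and> continuous_on U G \<and>
        \<Omega> \<inter> U = {x \<in> U. \<phi> x < (0::real)})"


section \<open>Distributional divergence\<close>

fun Ck :: "nat \<Rightarrow> (real ^ 3 \<Rightarrow> real) \<Rightarrow> bool" where
  "Ck 0 \<phi> \<longleftrightarrow> continuous_on UNIV \<phi>"
| "Ck (Suc m) \<phi> \<longleftrightarrow>
     (\<exists>G. (\<forall>x. GDERIV \<phi> x :> G x) \<and> (\<forall>i. Ck m (\<lambda>x. G x $ i)))"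

definition test_function :: "(real ^ 3) set \<Rightarrow> (real ^ 3 \<Rightarrow> real) \<Rightarrow> bool" where
  "test_function \<Omega> \<phi> \<longleftrightarrow>
     (\<forall>m. Ck m \<phi>) \<and> (\<exists>K. compact K \<and> K \<subseteq> \<Omega> \<and> (\<forall>x. x \<notin> K \<longrightarrow> \<phi> x = 0))"

definition divergence_free_on :: "(real ^ 3) set \<Rightarrow> (real ^ 3 \<Rightarrow> real ^ 3) \<Rightarrow> bool" where
  "divergence_free_on \<Omega> F \<longleftrightarrow>
     (\<forall>K. compact K \<and> K \<subseteq> \<Omega> \<longrightarrow> set_integrable lborel K F) \<and>
     (\<forall>\<phi> G. test_function \<Omega> \<phi> \<and> (\<forall>x. GDERIV \<phi> x :> G x) \<longrightarrow>
        (LINT x:\<Omega>|lborel. F x \<bullet> G x) = 0)"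


section \<open>Radiative transfer\<close>

definition planck :: "real \<Rightarrow> real \<Rightarrow> real \<Rightarrow> real \<Rightarrow> real \<Rightarrow> real" where
  "planck h c k \<nu> T =
     (if T = 0 then 0 else 2 * h * \<nu> ^ 3 / c\<^sup>2 * (1 / (exp (h * \<nu> / (k * T)) - 1)))"

definition emission :: "real \<Rightarrow> real \<Rightarrow> real \<Rightarrow> (real \<Rightarrow> real) \<Rightarrow> real \<Rightarrow> real" where
  "emission h c k \<alpha> T = (\<integral>\<nu>. \<alpha> \<nu> * planck h c k \<nu> T \<partial>freq)"

text \<open>
  For a bounded convex open set and an interior point, the backward ray meets the boundary in
  exactly one point, so the description below is proper.
\<close>

definition back_point :: "(real ^ 3) set \<Rightarrow> real ^ 3 \<Rightarrow> real ^ 3 \<Rightarrow> real ^ 3" where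
  "back_point \<Omega> x n = (THE y. y \<in> frontier \<Omega> \<and> (\<exists>t\<ge>0. y = x - t *\<^sub>R n))"

definition back_dist :: "(real ^ 3) set \<Rightarrow> real ^ 3 \<Rightarrow> real ^ 3 \<Rightarrow> real" where
  "back_dist \<Omega> x n = dist x (back_point \<Omega> x n)"

text \<open>
  Solution of the transport equation with temperature \<open>T\<close>, obtained by integrating along the ray
  from its entry point, where the incoming boundary value is \<open>g \<nu> n\<close>.
\<close>

definition intensity ::
  "(real ^ 3) set \<Rightarrow> real \<Rightarrow> real \<Rightarrow> real \<Rightarrow> (real \<Rightarrow> real) \<Rightarrow> (real \<Rightarrow> real ^ 3 \<Rightarrow> real) \<Rightarrow>
    (real ^ 3 \<Rightarrow> real) \<Rightarrow> real \<Rightarrow> real ^ 3 \<Rightarrow> real ^ 3 \<Rightarrow> real" where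
  "intensity \<Omega> h c k \<alpha> g T \<nu> x n =
     g \<nu> n * exp (- \<alpha> \<nu> * back_dist \<Omega> x n) +
     \<alpha> \<nu> * (LINT \<xi>:{0..back_dist \<Omega> x n}|lborel.
        exp (- \<alpha> \<nu> * (back_dist \<Omega> x n - \<xi>)) *
        planck h c k \<nu> (T (back_point \<Omega> x n + \<xi> *\<^sub>R n)))"

definition flux ::
  "(real ^ 3) set \<Rightarrow> real \<Rightarrow> real \<Rightarrow> real \<Rightarrow> (real \<Rightarrow> real) \<Rightarrow> (real \<Rightarrow> real ^ 3 \<Rightarrow> real) \<Rightarrow>
    (real ^ 3 \<Rightarrow> real) \<Rightarrow> real ^ 3 \<Rightarrow> real ^ 3" where
  "flux \<Omega> h c k \<alpha> g T x =
     (\<integral>\<nu>. (\<integral>n. intensity \<Omega> h c k \<alpha> g T \<nu> x n *\<^sub>R n \<partial>sphere_surface) \<partial>freq)"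

text \<open>
  Temperatures are Borel representatives of Lebesgue classes on the domain.  The integrability
  condition only says that the flux integral converges absolutely; without it, Bochner integrals
  would silently take the value 0.
\<close>

definition radiative_solution ::
  "(real ^ 3) set \<Rightarrow> real \<Rightarrow> real \<Rightarrow> real \<Rightarrow> (real \<Rightarrow> real) \<Rightarrow> (real \<Rightarrow> real ^ 3 \<Rightarrow> real) \<Rightarrow>
    (real ^ 3 \<Rightarrow> real) \<Rightarrow> bool" where
  "radiative_solution \<Omega> h c k \<alpha> g T \<longleftrightarrow>
     T \<in> borel_measurable (restrict_space borel \<Omega>) \<and>
     (\<forall>x\<in>\<Omega>. T x \<ge> 0) \<and>
     (AE x\<in>\<Omega> in lborel.
        integrable (freq \<Otimes>\<^sub>M sphere_surface) (\<lambda>(\<nu>, n). intensity \<Omega> h c k \<alpha> g T \<nu> x n)) \<and>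
     divergence_free_on \<Omega> (flux \<Omega> h c k \<alpha> g T)"

definition Linf_nonneg :: "(real ^ 3) set \<Rightarrow> (real ^ 3 \<Rightarrow> real) \<Rightarrow> bool" where
  "Linf_nonneg \<Omega> u \<longleftrightarrow>
     u \<in> borel_measurable (restrict_space borel \<Omega>) \<and>
     (\<exists>M. AE x\<in>\<Omega> in lborel. 0 \<le> u x \<and> u x \<le> M)"

end

theory Submission
  imports Defs "HOL-Probability.Distributions"
begin

text \<open>
  The intensity along a ray is an attenuated average: at \<open>x\<close> in direction \<open>n\<close> it is the mean of a
  source at the point \<open>x - r n\<close>, where the length \<open>r\<close> of the flight is exponentially distributed with
  rate \<open>\<alpha>\<close>.  The source is the Planck emission inside the domain, and the incoming radiation \<open>g\<close>
  is obtained by letting the exterior emit \<open>g\<close> (\<open>intensity_eq_field\<close>).  The boundary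
  value problem thereby becomes a problem on the whole space without boundary terms.

  Attenuated averages have a simple adjoint (the flight reversed, \<open>attenuate_adjoint\<close>) and solve the
  transport equation (\<open>attenuate_by_parts\<close>).  Hence the flux tested against a gradient equals the
  test function integrated against the energy exchange, absorbed minus emitted power
  (\<open>weak_conservation_law\<close>).  So the flux is divergence-free if the exchange vanishes in the domain,
  and conversely, by the fundamental lemma of the calculus of variations, the exchange vanishes almost
  everywhere if the flux is divergence-free.  The equation to solve is therefore that every point emits
  what it absorbs.

  Both halves of the theorem follow from monotonicity of the Planck emission in the temperature and
  from one quantitative fact: in a domain of diameter \<open>D\<close> at least the fraction \<open>exp (- \<alpha> D)\<close> of the
  radiation escapes (\<open>attenuate_indicator_le\<close>).  For two solutions this makes the map from the emitted to
  the reabsorbed power a strict contraction of the \<open>L\<^sup>1\<close> distance at every frequency, which gives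
  uniqueness (\<open>exchange_zero_unique\<close>).  For existence it makes a large constant temperature a
  supersolution (\<open>constant_supersolution\<close>), and the increasing iteration that starts from zero
  temperature converges below it (\<open>radiative_solution_exists\<close>).

  A solution may be unbounded on a null set.  Such a set is met with positive length by almost no ray through
  almost every point, so the temperature can be replaced by a bounded representative
  (\<open>AE_same_intensity\<close>, \<open>bounded_representative\<close>).
\<close>

section \<open>Smooth bump functions and the fundamental lemma of the calculus of variations\<close>

text \<open>
  For \<open>q = 1\<close> this is the classical smooth function that is flat at the origin.  The polynomial
  factor makes the family closed under differentiation, so that one derivative formula gives
  derivatives of all orders.
\<close>

definition flat :: "real poly \<Rightarrow> real \<Rightarrow> real" where
  "flat q t = (if t > 0 then poly q (1 / t) * exp (- (1 / t)) else 0)"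

lemma poly_exp_tendsto_0: "((\<lambda>s. poly q s * exp (- s)) \<longlongrightarrow> 0) (at_top :: real filter)"
proof -
  have "((\<lambda>s. \<Sum>i\<le>degree q. coeff q i * (s ^ i / exp s)) \<longlongrightarrow> (\<Sum>i\<le>degree q. coeff q i * 0)) at_top"
    by (intro tendsto_sum tendsto_mult tendsto_const tendsto_power_div_exp_0)
  then show ?thesis
    by (simp add: poly_altdef sum_distrib_right exp_minus divide_inverse mult.assoc)
qed

text \<open>
  Only the origin needs an argument: there the difference quotient from the right is again of the
  form \<open>s q(s) exp (- s)\<close> with \<open>s = 1 / t\<close> tending to infinity.
\<close>

lemma DERIV_flat: "(flat q has_real_derivative flat ([:0, 0, 1:] * (q - pderiv q)) t) (at t)"
proof -
  let ?q' = "[:0, 0, 1:] * (q - pderiv q)"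
  consider "t > 0" | "t < 0" | "t = 0" by linarith
  then show ?thesis
  proof cases
    case 1
    have "((\<lambda>t. poly q (1 / t) * exp (- (1 / t))) has_real_derivative flat ?q' t) (at t)"
      using 1 by (auto intro!: derivative_eq_intros DERIV_chain2[OF poly_DERIV]
          simp: flat_def field_simps power2_eq_square)
    then show ?thesis
      by (rule has_field_derivative_transform_within_open[where S="{0<..}"])
         (use 1 in \<open>auto simp: flat_def\<close>)
  next
    case 2
    have "((\<lambda>t. 0) has_real_derivative flat ?q' t) (at t)"
      using 2 by (simp add: flat_def)
    then show ?thesis
      by (rule has_field_derivative_transform_within_open[where S="{..<0}"])
         (use 2 in \<open>auto simp: flat_def\<close>)
  next
    case 3
    have "((\<lambda>y. (flat q y - flat q 0) / (y - 0)) \<longlongrightarrow> 0) (at_right 0)"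
    proof -
      have "((\<lambda>y. poly (pCons 0 q) (inverse y) * exp (- inverse y)) \<longlongrightarrow> 0) (at_right 0)"
        by (rule filterlim_compose[OF poly_exp_tendsto_0 filterlim_inverse_at_top_right])
      then show ?thesis
        by (rule Lim_transform_eventually)
           (auto simp: eventually_at_filter flat_def field_simps intro!: always_eventually)
    qed
    moreover have "((\<lambda>y. (flat q y - flat q 0) / (y - 0)) \<longlongrightarrow> 0) (at_left 0)"
      by (rule Lim_transform_eventually[OF tendsto_const])
         (auto simp: eventually_at_filter flat_def intro!: always_eventually)
    ultimately show ?thesis
      using 3 by (simp add: has_field_derivative_iff filterlim_split_at flat_def)
  qed
qed

lemma Ck_Suc_imp_Ck: "Ck (Suc m) \<phi> \<Longrightarrow> Ck m \<phi>"
proof (induction m arbitrary: \<phi>)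
  case 0
  then show ?case
    by (auto simp: gderiv_def continuous_on_eq_continuous_at dest!: has_derivative_continuous)
next
  case (Suc m)
  then show ?case by (metis Ck.simps(2))
qed

lemma Ck_const: "Ck m (\<lambda>x. c)"
  by (induction m arbitrary: c) (auto intro!: exI[of _ "\<lambda>x. 0"] GDERIV_const)

lemma Ck_add: "Ck m \<phi> \<Longrightarrow> Ck m \<psi> \<Longrightarrow> Ck m (\<lambda>x. \<phi> x + \<psi> x)"
proof (induction m arbitrary: \<phi> \<psi>)
  case 0
  then show ?case by (auto intro: continuous_intros)
next
  case (Suc m)
  then obtain F G where "\<And>x. GDERIV \<phi> x :> F x" "\<And>i. Ck m (\<lambda>x. F x $ i)"
    "\<And>x. GDERIV \<psi> x :> G x" "\<And>i. Ck m (\<lambda>x. G x $ i)" by auto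
  then show ?case
    using Suc.IH by (auto intro!: exI[of _ "\<lambda>x. F x + G x"] GDERIV_add)
qed

lemma Ck_mult: "Ck m \<phi> \<Longrightarrow> Ck m \<psi> \<Longrightarrow> Ck m (\<lambda>x. \<phi> x * \<psi> x)"
proof (induction m arbitrary: \<phi> \<psi>)
  case 0
  then show ?case by (auto intro: continuous_intros)
next
  case (Suc m)
  then obtain F G where FG: "\<And>x. GDERIV \<phi> x :> F x" "\<And>i. Ck m (\<lambda>x. F x $ i)"
    "\<And>x. GDERIV \<psi> x :> G x" "\<And>i. Ck m (\<lambda>x. G x $ i)" by auto
  moreover have "Ck m \<phi>" "Ck m \<psi>"
    using Suc.prems Ck_Suc_imp_Ck by blast+
  ultimately show ?case
    using Suc.IH
    by (auto intro!: exI[of _ "\<lambda>x. \<phi> x *\<^sub>R G x + \<psi> x *\<^sub>R F x"] GDERIV_mult Ck_add)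
qed

lemma Ck_flat_coord: "Ck m (\<lambda>x. flat q (a * x $ i + b))"
proof (induction m arbitrary: q)
  case 0
  have "continuous_on UNIV (flat q)"
    by (meson DERIV_continuous_on DERIV_flat DERIV_subset subset_UNIV)
  then show ?case
    by (auto intro!: continuous_on_compose2[of UNIV "flat q"] continuous_intros)
next
  case (Suc m)
  let ?q' = "[:0, 0, 1:] * (q - pderiv q)"
  have "GDERIV (\<lambda>x. flat q (a * x $ i + b)) x :> (flat ?q' (a * x $ i + b) * a) *\<^sub>R axis i 1" for x :: "real ^ 3"
  proof -
    have "((\<lambda>x. a * x $ i + b) has_derivative (\<lambda>h. a * h $ i)) (at x)"
      by (auto intro!: derivative_eq_intros bounded_linear_imp_has_derivative bounded_linear_vec_nth)
    from has_derivative_compose[OF this DERIV_flat[of q, unfolded has_field_derivative_def]]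
    show ?thesis
      unfolding gderiv_def by (simp add: inner_axis mult_ac)
  qed
  moreover have "Ck m (\<lambda>x. ((flat ?q' (a * x $ i + b) * a) *\<^sub>R axis i (1::real)) $ j)" for j
    using Suc.IH[of ?q'] by (auto intro!: Ck_mult Ck_const)
  ultimately show ?case
    unfolding Ck.simps by (intro exI[of _ "\<lambda>x. (flat ?q' (a * x $ i + b) * a) *\<^sub>R axis i 1"]) blast
qed

text \<open>
  With \<open>q = 1\<close>, scaling the argument of \<^term>\<open>flat\<close> by \<open>N\<close> is the same as taking an \<open>N\<close>-th root of its
  value.  The scaled bumps are therefore positive exactly on the box and converge there to 1, which
  makes them smooth approximations of the indicator function from inside the box.
\<close>

definition box_bump :: "real ^ 3 \<Rightarrow> real ^ 3 \<Rightarrow> real \<Rightarrow> real ^ 3 \<Rightarrow> real" where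
  "box_bump a b N x =
     (\<Prod>i\<in>UNIV. flat 1 (N * x $ i + - (N * a $ i)) * flat 1 (- N * x $ i + N * b $ i))"

lemma Ck_prod: "finite I \<Longrightarrow> (\<And>i. i \<in> I \<Longrightarrow> Ck m (f i)) \<Longrightarrow> Ck m (\<lambda>x. \<Prod>i\<in>I. f i x)"
  by (induction I rule: finite_induct) (auto intro: Ck_const Ck_mult)

lemma flat_1_bounds: "0 \<le> flat 1 t" "flat 1 t \<le> 1"
  by (auto simp: flat_def)

lemma box_bump_bounds: "0 \<le> box_bump a b N x" "box_bump a b N x \<le> 1"
  unfolding box_bump_def
  by (auto intro!: prod_nonneg prod_le_1 mult_nonneg_nonneg mult_le_one simp: flat_1_bounds)

lemma box_bump_eq_0:
  assumes "N > 0" "x \<notin> box a b"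
  shows "box_bump a b N x = 0"
proof -
  obtain i where "x $ i \<le> a $ i \<or> b $ i \<le> x $ i"
    using assms(2) by (auto simp: mem_box_cart not_less)
  then have "flat 1 (N * x $ i + - (N * a $ i)) * flat 1 (- N * x $ i + N * b $ i) = 0"
    using assms(1) by (auto simp: flat_def mult_left_mono dest: mult_left_mono[of _ _ N])
  then show ?thesis
    unfolding box_bump_def by (intro prod_zero) (auto intro!: bexI[of _ i])
qed

lemma test_function_box_bump:
  assumes "N > 0" "cbox a b \<subseteq> \<Omega>"
  shows "test_function \<Omega> (box_bump a b N)"
  unfolding test_function_def
proof (intro conjI allI exI)
  show "Ck m (box_bump a b N)" for m
    unfolding box_bump_def by (intro Ck_prod Ck_mult Ck_flat_coord) auto
  show "compact (cbox a b)" "cbox a b \<subseteq> \<Omega>" using assms by auto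
  show "x \<notin> cbox a b \<longrightarrow> box_bump a b N x = 0" for x
    using assms box_bump_eq_0 box_subset_cbox by blast
qed

lemma box_bump_tendsto:
  "(\<lambda>N. box_bump a b (real (Suc N)) x) \<longlonglongrightarrow> indicator (box a b) x"
proof (cases "x \<in> box a b")
  case True
  have lim: "(\<lambda>N. flat 1 (real (Suc N) * t)) \<longlonglongrightarrow> 1" if "t > 0" for t
  proof -
    have "(\<lambda>N. exp (- (1 / (real (Suc N) * t)))) \<longlonglongrightarrow> exp (- (0 * (1 / t)))"
      using tendsto_mult[OF LIMSEQ_inverse_real_of_nat tendsto_const[of "1 / t"]]
      by (intro tendsto_exp tendsto_minus) (simp add: field_simps)
    then show ?thesis using that by (simp add: flat_def del: of_nat_Suc)
  qed
  have "(\<lambda>N. \<Prod>i\<in>UNIV. flat 1 (real (Suc N) * (x $ i - a $ i)) * flat 1 (real (Suc N) * (b $ i - x $ i)))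
     \<longlonglongrightarrow> (\<Prod>i\<in>(UNIV::3 set). 1 * 1)"
    using True by (intro tendsto_prod tendsto_mult lim) (auto simp: mem_box_cart)
  then show ?thesis
    using True by (simp add: box_bump_def algebra_simps)
next
  case False
  then show ?thesis by (simp add: box_bump_eq_0)
qed

text \<open>
  The positive and the negative part of \<open>f\<close> are densities of two measures that agree on the
  intersection-stable generator of all boxes, hence everywhere.
\<close>

lemma AE_zero_if_box_integrals_zero:
  fixes f :: "'a::euclidean_space \<Rightarrow> real"
  assumes f: "integrable lborel f"
    and zero: "\<And>a b. (LINT x:box a b|lborel. f x) = 0"
  shows "AE x in lborel. f x = 0"
proof -
  note [measurable] = borel_measurable_integrable[OF f]
  let ?p = "\<lambda>x. max 0 (f x)" and ?n = "\<lambda>x. max 0 (- f x)"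
  have ip: "integrable lborel ?p" "integrable lborel ?n"
    using f by (auto intro!: integrable_max)
  have "density lborel (\<lambda>x. ennreal (?p x)) = density lborel (\<lambda>x. ennreal (?n x))"
  proof (rule measure_eqI_generator_eq[where E="range (\<lambda>(a, b). box a b)" and \<Omega>=UNIV
        and A="\<lambda>n. box (- (real n *\<^sub>R One)) (real n *\<^sub>R One)"])
    show "Int_stable (range (\<lambda>(a, b). box a b :: 'a set))"
      by (auto simp: Int_stable_def box_Int_box)
    show "sets (density lborel (\<lambda>x. ennreal (?p x))) = sigma_sets UNIV (range (\<lambda>(a, b). box a b))"
      "sets (density lborel (\<lambda>x. ennreal (?n x))) = sigma_sets UNIV (range (\<lambda>(a, b). box a b))"
      by (simp_all add: borel_eq_box)
    show "range (\<lambda>n. box (- (real n *\<^sub>R One)) (real n *\<^sub>R One :: 'a)) \<subseteq> range (\<lambda>(a, b). box a b)"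
      by auto
    show "(\<Union>n. box (- (real n *\<^sub>R One)) (real n *\<^sub>R One :: 'a)) = UNIV"
      by (auto simp: UN_box_eq_UNIV)
    have em: "emeasure (density lborel (\<lambda>x. ennreal (h x))) X = ennreal (LINT x:X|lborel. h x)"
      if "integrable lborel h" "X \<in> sets borel" "\<And>x. 0 \<le> h x" for h :: "'a \<Rightarrow> real" and X
    proof -
      have "emeasure (density lborel (\<lambda>x. ennreal (h x))) X = (\<integral>\<^sup>+x. ennreal (indicator X x * h x) \<partial>lborel)"
        using that by (auto simp: emeasure_density indicator_def intro!: nn_integral_cong)
      also have "\<dots> = ennreal (LINT x:X|lborel. h x)"
        unfolding set_lebesgue_integral_def using that integrable_mult_indicator[of X lborel h]
        by (subst nn_integral_eq_integral) auto
      finally show ?thesis .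
    qed
    show "emeasure (density lborel (\<lambda>x. ennreal (?p x))) X = emeasure (density lborel (\<lambda>x. ennreal (?n x))) X"
      if X_box: "X \<in> range (\<lambda>(a, b). box a b)" for X
    proof -
      obtain a b where X: "X = box a b" using X_box by auto
      have "set_integrable lborel X ?p" "set_integrable lborel X ?n"
        unfolding set_integrable_def by (intro integrable_mult_indicator ip; simp add: X)+
      then have "(LINT x:X|lborel. ?p x) - (LINT x:X|lborel. ?n x) = (LINT x:X|lborel. ?p x - ?n x)"
        by (rule set_integral_diff(2)[symmetric])
      also have "(\<lambda>x. ?p x - ?n x) = f"
        by (auto simp: max_def)
      finally show ?thesis using zero X ip by (simp add: em)
    qed
    show "emeasure (density lborel (\<lambda>x. ennreal (?p x))) (box (- (real i *\<^sub>R One)) (real i *\<^sub>R One)) \<noteq> \<infinity>" for i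
      using ip by (simp add: em)
  qed auto
  then have "AE x in lborel. ennreal (?p x) = ennreal (?n x)"
    by (subst (asm) sigma_finite_measure.density_unique_iff[OF lborel.sigma_finite_measure_axioms]) auto
  then show ?thesis
    by eventually_elim (auto simp: max_def split: if_splits)
qed

text \<open>
  Dominated convergence along the bumps turns the hypothesis into vanishing integrals over the boxes
  whose closure lies in the open set.  Inside one such box every box is admissible, so the previous
  lemma applies there, and countably many of them cover the open set.
\<close>

lemma fundamental_lemma:
  fixes \<psi> :: "real ^ 3 \<Rightarrow> real"
  assumes "open \<Omega>" and \<psi>: "integrable lborel \<psi>"
    and zero: "\<And>\<phi>. test_function \<Omega> \<phi> \<Longrightarrow> (LINT x|lborel. \<phi> x * \<psi> x) = 0"
  shows "AE x\<in>\<Omega> in lborel. \<psi> x = 0"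
proof -
  have box0: "(LINT x:box a b|lborel. \<psi> x) = 0" if "cbox a b \<subseteq> \<Omega>" for a b
  proof -
    have "(\<lambda>N. LINT x|lborel. box_bump a b (real (Suc N)) x * \<psi> x) \<longlonglongrightarrow> (LINT x|lborel. indicator (box a b) x * \<psi> x)"
    proof (rule integral_dominated_convergence[where w="\<lambda>x. \<bar>\<psi> x\<bar>"])
      show "AE x in lborel. (\<lambda>N. box_bump a b (real (Suc N)) x * \<psi> x) \<longlonglongrightarrow> indicator (box a b) x * \<psi> x"
        by (intro AE_I2 tendsto_mult box_bump_tendsto tendsto_const)
      show "AE x in lborel. norm (box_bump a b (real (Suc N)) x * \<psi> x) \<le> \<bar>\<psi> x\<bar>" for N
        using box_bump_bounds[of a b "real (Suc N)"]
        by (intro AE_I2) (auto simp: abs_mult intro!: mult_left_le_one_le)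
      have "continuous_on UNIV (box_bump a b (real (Suc N)))" for N
        using test_function_box_bump[of "real (Suc N)" a b UNIV]
        unfolding test_function_def by (metis Ck.simps(1) of_nat_0_less_iff subset_UNIV zero_less_Suc)
      then have [measurable]: "box_bump a b (real (Suc N)) \<in> borel_measurable borel" for N
        by (rule borel_measurable_continuous_onI)
      show "(\<lambda>x. box_bump a b (real (Suc N)) x * \<psi> x) \<in> borel_measurable lborel" for N
        using \<psi> by measurable
    qed (use \<psi> in auto)
    moreover have "(LINT x|lborel. box_bump a b (real (Suc N)) x * \<psi> x) = 0" for N
      using that by (intro zero test_function_box_bump) auto
    ultimately show ?thesis
      using LIMSEQ_unique[OF _ tendsto_const] by (fastforce simp: set_lebesgue_integral_def)
  qed
  have ae_box: "AE x in lborel. x \<in> box a b \<longrightarrow> \<psi> x = 0" if ab: "cbox a b \<subseteq> \<Omega>" for a b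
  proof -
    have "AE x in lborel. indicator (box a b) x * \<psi> x = 0"
    proof (rule AE_zero_if_box_integrals_zero)
      show "integrable lborel (\<lambda>x. indicator (box a b) x * \<psi> x)"
        using integrable_mult_indicator[OF _ \<psi>, of "box a b"] by simp
      fix c d :: "real ^ 3"
      obtain c' d' where cd: "box c d \<inter> box a b = box c' d'" "box c' d' = {} \<or> cbox c' d' \<subseteq> cbox a b"
      proof (cases "box c d \<inter> box a b = {}")
        case True
        then show ?thesis using that[of 0 0] by auto
      next
        case False
        obtain c' d' where *: "box c d \<inter> box a b = box c' d'" using box_Int_box by blast
        then have "box c' d' \<noteq> {}" "box c' d' \<subseteq> box a b" using False by auto
        moreover from this have "box a b \<noteq> {}" by auto
        ultimately have "cbox c' d' \<subseteq> cbox a b"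
          using closure_mono[of "box c' d'" "box a b"] by (simp add: closure_box)
        then show ?thesis using that * by blast
      qed
      have "(LINT x:box c d|lborel. indicator (box a b) x * \<psi> x) = (LINT x:box c' d'|lborel. \<psi> x)"
        unfolding set_lebesgue_integral_def cd(1)[symmetric]
        by (rule Bochner_Integration.integral_cong) (auto simp: indicator_def)
      also have "\<dots> = 0"
        using cd(2)
      proof
        assume "box c' d' = {}"
        then show ?thesis by (simp add: set_lebesgue_integral_def)
      next
        assume "cbox c' d' \<subseteq> cbox a b"
        then show ?thesis using ab by (intro box0) simp
      qed
      finally show "(LINT x:box c d|lborel. indicator (box a b) x * \<psi> x) = 0" .
    qed
    then show ?thesis by eventually_elim (auto simp: indicator_def)
  qed
  let ?F = "{box a b | a b. cbox a b \<subseteq> \<Omega>}"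
  have cover: "\<Union>?F = \<Omega>"
  proof
    show "\<Union>?F \<subseteq> \<Omega>" using box_subset_cbox by blast
    show "\<Omega> \<subseteq> \<Union>?F"
    proof
      fix x assume "x \<in> \<Omega>"
      then obtain a b where "cbox a b \<subseteq> \<Omega>" "x \<in> box a b"
        using \<open>open \<Omega>\<close> open_contains_cbox by metis
      then show "x \<in> \<Union>?F" by blast
    qed
  qed
  obtain \<D> where D: "\<D> \<subseteq> ?F" "countable \<D>" "\<Union>\<D> = \<Union>?F"
    by (rule Lindelof[of ?F]) auto
  have ae: "AE x in lborel. \<forall>X\<in>\<D>. x \<in> X \<longrightarrow> \<psi> x = 0"
    unfolding AE_ball_countable[OF D(2)]
  proof
    fix X assume "X \<in> \<D>"
    then have "X \<in> ?F" using D(1) by (rule rev_subsetD)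
    then obtain a b where "X = box a b" "cbox a b \<subseteq> \<Omega>" by auto
    then show "AE x in lborel. x \<in> X \<longrightarrow> \<psi> x = 0" using ae_box by simp
  qed
  have D_cover: "\<Union>\<D> = \<Omega>"
    using D(3) cover by (rule trans)
  show ?thesis
    using ae
  proof eventually_elim
    case (elim x)
    show ?case
    proof
      assume "x \<in> \<Omega>"
      then obtain X where "X \<in> \<D>" "x \<in> X"
        unfolding D_cover[symmetric] by (rule UnionE)
      then show "\<psi> x = 0" using elim by blast
    qed
  qed
qed

section \<open>Attenuated averages along rays\<close>

lemma integrable_mult_prod:
  fixes f :: "'a \<Rightarrow> real" and h :: "'b \<Rightarrow> real"
  assumes "sigma_finite_measure M1" "sigma_finite_measure M2"
    and f: "integrable M1 f" and h: "integrable M2 h"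
  shows "integrable (M1 \<Otimes>\<^sub>M M2) (\<lambda>(x, y). f x * h y)"
proof (rule pair_sigma_finite.Fubini_integrable)
  show "pair_sigma_finite M1 M2"
    using assms(1,2) by (rule pair_sigma_finite.intro)
  have [measurable]: "f \<in> borel_measurable M1" "h \<in> borel_measurable M2"
    using f h by auto
  show "(\<lambda>(x, y). f x * h y) \<in> borel_measurable (M1 \<Otimes>\<^sub>M M2)"
    by measurable
  show "integrable M1 (\<lambda>x. \<integral>y. norm (case (x, y) of (x, y) \<Rightarrow> f x * h y) \<partial>M2)"
    using f h by (simp add: abs_mult)
  show "AE x in M1. integrable M2 (\<lambda>y. case (x, y) of (x, y) \<Rightarrow> f x * h y)"
    using h by simp
qed

lemma integral_erlang_density:
  assumes "0 < a"
  shows "integrable lborel (erlang_density m a)"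
    and "(LINT r|lborel. erlang_density m a r) = 1"
proof -
  interpret prob_space "density lborel (erlang_density m a)"
    by (rule prob_space_erlang_density) fact
  have nn: "(\<integral>\<^sup>+r. ennreal (erlang_density m a r) \<partial>lborel) = 1"
    using emeasure_space_1 by (simp add: emeasure_density)
  then show int: "integrable lborel (erlang_density m a)"
    using assms by (intro integrableI_nonneg) auto
  show "(LINT r|lborel. erlang_density m a r) = 1"
    using nn assms by (subst integral_eq_nn_integral) auto
qed

text \<open>
  The mean of \<open>b\<close> at the end point of a flight from \<open>x\<close> in direction \<open>- n\<close> whose length is
  exponentially distributed with rate \<open>a\<close>.  This is the bounded solution \<open>u\<close> of the transport equation
  \<open>n \<bullet> \<nabla>u = a (b - u)\<close> on the whole space.
\<close>

definition attenuate :: "real \<Rightarrow> 'a::euclidean_space \<Rightarrow> ('a \<Rightarrow> real) \<Rightarrow> 'a \<Rightarrow> real" where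
  "attenuate a n b x = (LINT r|lborel. exponential_density a r * b (x - r *\<^sub>R n))"

lemma measurable_exponential_density2 [measurable (raw)]:
  assumes [measurable]: "A \<in> borel_measurable M" "R \<in> borel_measurable M"
  shows "(\<lambda>p. exponential_density (A p) (R p)) \<in> borel_measurable M"
  unfolding exponential_density_def by measurable

lemma measurable_attenuate [measurable (raw)]:
  fixes N :: "'p \<Rightarrow> 'a::euclidean_space"
  assumes [measurable]: "A \<in> borel_measurable M" "N \<in> M \<rightarrow>\<^sub>M borel" "X \<in> M \<rightarrow>\<^sub>M borel"
    and b: "(\<lambda>(p, z). b p z) \<in> borel_measurable (M \<Otimes>\<^sub>M borel)"
  shows "(\<lambda>p. attenuate (A p) (N p) (b p) (X p)) \<in> borel_measurable M"
proof -
  have "(\<lambda>q. (fst q, X (fst q) - snd q *\<^sub>R N (fst q))) \<in> (M \<Otimes>\<^sub>M lborel) \<rightarrow>\<^sub>M (M \<Otimes>\<^sub>M borel)"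
    by measurable
  from measurable_compose[OF this b]
  have [measurable]: "(\<lambda>q. b (fst q) (X (fst q) - snd q *\<^sub>R N (fst q))) \<in> borel_measurable (M \<Otimes>\<^sub>M lborel)"
    by simp
  have "(\<lambda>(p, r). exponential_density (A p) r * b p (X p - r *\<^sub>R N p)) \<in> borel_measurable (M \<Otimes>\<^sub>M lborel)"
    unfolding case_prod_beta by measurable
  then show ?thesis
    unfolding attenuate_def by (rule lborel.borel_measurable_lebesgue_integral)
qed

context
  fixes a :: real and n :: "'a::euclidean_space"
  assumes a: "0 < a"
begin

lemma integrable_attenuate:
  assumes [measurable]: "b \<in> borel_measurable borel" and M: "\<And>z. \<bar>b z\<bar> \<le> M"
  shows "integrable lborel (\<lambda>r. exponential_density a r * b (x - r *\<^sub>R n))"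
proof (rule Bochner_Integration.integrable_bound)
  show "integrable lborel (\<lambda>r. exponential_density a r * M)"
    using integral_erlang_density[OF a, of 0] by simp
  show "AE r in lborel. norm (exponential_density a r * b (x - r *\<^sub>R n)) \<le> norm (exponential_density a r * M)"
    using M order_trans[OF M abs_ge_self] exponential_density_nonneg[OF a]
    by (intro AE_I2) (auto simp: abs_mult intro!: mult_left_mono)
qed measurable

lemma attenuate_const: "attenuate a n (\<lambda>z. k) x = k"
  using integral_erlang_density[OF a, of 0] by (simp add: attenuate_def)

lemma attenuate_mono:
  assumes "b1 \<in> borel_measurable borel" "\<And>z. \<bar>b1 z\<bar> \<le> M1"
    and "b2 \<in> borel_measurable borel" "\<And>z. \<bar>b2 z\<bar> \<le> M2"
    and "\<And>z. b1 z \<le> b2 z"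
  shows "attenuate a n b1 x \<le> attenuate a n b2 x"
  unfolding attenuate_def
  using assms integrable_attenuate[OF assms(1,2)] integrable_attenuate[OF assms(3,4)]
  by (intro integral_mono) (auto intro!: mult_left_mono exponential_density_nonneg a)

lemma attenuate_nonneg:
  assumes "\<And>z. 0 \<le> b z"
  shows "0 \<le> attenuate a n b x"
  unfolding attenuate_def
  using assms exponential_density_nonneg[OF a] by (intro Bochner_Integration.integral_nonneg) auto

lemma attenuate_le:
  assumes "b \<in> borel_measurable borel" "\<And>z. \<bar>b z\<bar> \<le> M"
  shows "\<bar>attenuate a n b x\<bar> \<le> M"
proof -
  have "M \<ge> 0" using assms(2) abs_ge_zero order_trans by blast
  have "attenuate a n b x \<le> attenuate a n (\<lambda>z. M) x"
    using assms \<open>M \<ge> 0\<close> by (intro attenuate_mono[of _ M _ M]) (auto simp: abs_le_iff)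
  moreover have "attenuate a n (\<lambda>z. - M) x \<le> attenuate a n b x"
    using assms \<open>M \<ge> 0\<close> by (intro attenuate_mono[of _ M _ M]) (auto simp: abs_le_iff, smt (verit))
  ultimately show ?thesis by (simp add: attenuate_const)
qed

lemma attenuate_add:
  assumes "b1 \<in> borel_measurable borel" "\<And>z. \<bar>b1 z\<bar> \<le> M1"
    and "b2 \<in> borel_measurable borel" "\<And>z. \<bar>b2 z\<bar> \<le> M2"
  shows "attenuate a n (\<lambda>z. b1 z + b2 z) x = attenuate a n b1 x + attenuate a n b2 x"
  using integrable_attenuate[OF assms(1,2)] integrable_attenuate[OF assms(3,4)]
  by (simp add: attenuate_def distrib_left)

lemma attenuate_cmult: "attenuate a n (\<lambda>z. k * b z) x = k * attenuate a n b x"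
  by (simp add: attenuate_def mult.left_commute)

lemma attenuate_abs_diff:
  assumes "b1 \<in> borel_measurable borel" "\<And>z. \<bar>b1 z\<bar> \<le> M1"
    and "b2 \<in> borel_measurable borel" "\<And>z. \<bar>b2 z\<bar> \<le> M2"
  shows "\<bar>attenuate a n b1 x - attenuate a n b2 x\<bar> \<le> attenuate a n (\<lambda>z. \<bar>b1 z - b2 z\<bar>) x"
proof -
  have "attenuate a n b1 x - attenuate a n b2 x = (LINT r|lborel. exponential_density a r * (b1 (x - r *\<^sub>R n) - b2 (x - r *\<^sub>R n)))"
    using integrable_attenuate[OF assms(1,2)] integrable_attenuate[OF assms(3,4)]
    by (simp add: attenuate_def right_diff_distrib)
  also have "\<bar>\<dots>\<bar> \<le> (LINT r|lborel. \<bar>exponential_density a r * (b1 (x - r *\<^sub>R n) - b2 (x - r *\<^sub>R n))\<bar>)"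
    by (rule integral_abs_bound)
  also have "\<dots> = attenuate a n (\<lambda>z. \<bar>b1 z - b2 z\<bar>) x"
    using exponential_density_nonneg[OF a] by (simp add: attenuate_def abs_mult)
  finally show ?thesis .
qed

end

lemma lborel_integral_translate:
  fixes f :: "'a::euclidean_space \<Rightarrow> 'b::{banach, second_countable_topology}"
  assumes [measurable]: "f \<in> borel_measurable borel"
  shows "(LINT x|lborel. f x) = (LINT x|lborel. f (c + x))"
    and "integrable lborel f \<longleftrightarrow> integrable lborel (\<lambda>x. f (c + x))"
  by (subst lborel_distr_plus[symmetric, of c], simp add: integral_distr)
     (subst lborel_distr_plus[symmetric, of c], simp add: integrable_distr_eq)

text \<open>
  Reversing the direction of flight is the adjoint operation, because translations preserve
  Lebesgue measure.
\<close>

lemma attenuate_adjoint: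
  fixes n :: "'a::euclidean_space"
  assumes a: "0 < a"
    and b[measurable]: "b \<in> borel_measurable borel" and M: "\<And>z. \<bar>b z\<bar> \<le> M"
    and \<psi>: "integrable lborel \<psi>"
  shows "(LINT x|lborel. attenuate a n b x * \<psi> x) = (LINT y|lborel. b y * attenuate a (- n) \<psi> y)"
    and "integrable lborel (\<lambda>x. attenuate a n b x * \<psi> x)"
    and "integrable lborel (\<lambda>y. b y * attenuate a (- n) \<psi> y)"
proof -
  note [measurable] = borel_measurable_integrable[OF \<psi>]
  let ?e = "exponential_density a"
  have e0: "0 \<le> ?e r" for r by (rule exponential_density_nonneg[OF a])
  let ?F = "\<lambda>(r, x). ?e r * b (x - r *\<^sub>R n) * \<psi> x"
  let ?G = "\<lambda>(r, y). ?e r * b y * \<psi> (y + r *\<^sub>R n)"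
  have intF: "integrable (lborel \<Otimes>\<^sub>M lborel) ?F"
  proof (rule Bochner_Integration.integrable_bound)
    show "integrable (lborel \<Otimes>\<^sub>M lborel) (\<lambda>(r, x). (?e r * M) * \<psi> x)"
      using \<psi> integral_erlang_density[OF a, of 0] by (intro integrable_mult_prod lborel.sigma_finite_measure_axioms) auto
    show "AE q in lborel \<Otimes>\<^sub>M lborel. norm (?F q) \<le> norm ((\<lambda>(r, x). (?e r * M) * \<psi> x) q)"
      using M order_trans[OF M abs_ge_self] e0
      by (intro AE_I2) (auto simp: abs_mult intro!: mult_right_mono mult_left_mono)
  qed measurable
  have shift: "(LINT y|lborel. h (y + r *\<^sub>R n)) = (LINT x|lborel. h x)"
    if "h \<in> borel_measurable borel" for r and h :: "'a \<Rightarrow> real"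
    using lborel_integral_translate(1)[OF that, of "r *\<^sub>R n"] by (simp add: add.commute)
  have intG: "integrable (lborel \<Otimes>\<^sub>M lborel) ?G"
  proof (rule lborel_pair.Fubini_integrable)
    show "?G \<in> borel_measurable (lborel \<Otimes>\<^sub>M lborel)"
      by measurable
    have "(LINT y|lborel. norm (?G (r, y))) = (LINT x|lborel. norm (?F (r, x)))" for r
      using shift[of "\<lambda>x. norm (?F (r, x))" r] by simp
    then show "integrable lborel (\<lambda>r. LINT y|lborel. norm (?G (r, y)))"
      using lborel_pair.integrable_fst'[OF integrable_norm[OF intF]] by simp
    show "AE r in lborel. integrable lborel (\<lambda>y. ?G (r, y))"
    proof (rule AE_mp[OF lborel_pair.AE_integrable_fst'[OF intF] AE_I2], rule impI)
      fix r assume "integrable lborel (\<lambda>x. ?F (r, x))"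
      then show "integrable lborel (\<lambda>y. ?G (r, y))"
        using lborel_integral_translate(2)[of "\<lambda>x. ?F (r, x)" "r *\<^sub>R n"] by (simp add: add.commute)
    qed
  qed
  have G: "(LINT r|lborel. ?G (r, y)) = b y * attenuate a (- n) \<psi> y" for y
    by (simp add: attenuate_def mult_ac)
  show "integrable lborel (\<lambda>x. attenuate a n b x * \<psi> x)"
    using lborel_pair.integrable_snd[of "\<lambda>r x. ?F (r, x)"] intF by (simp add: attenuate_def)
  show "integrable lborel (\<lambda>y. b y * attenuate a (- n) \<psi> y)"
    using lborel_pair.integrable_snd[of "\<lambda>r x. ?G (r, x)"] intG G by simp
  have "(LINT x|lborel. attenuate a n b x * \<psi> x) = (LINT r|lborel. LINT x|lborel. ?F (r, x))"
    using lborel_pair.Fubini_integral[of "\<lambda>r x. ?F (r, x)"] intF by (simp add: attenuate_def)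
  also have "\<dots> = (LINT r|lborel. LINT y|lborel. ?G (r, y))"
  proof (rule Bochner_Integration.integral_cong)
    show "(LINT x|lborel. ?F (r, x)) = (LINT y|lborel. ?G (r, y))" for r
      using shift[of "\<lambda>x. ?F (r, x)" r] by simp
  qed simp
  also have "\<dots> = (LINT y|lborel. b y * attenuate a (- n) \<psi> y)"
    using lborel_pair.Fubini_integral[of "\<lambda>r x. ?G (r, x)"] intG G by simp
  finally show "(LINT x|lborel. attenuate a n b x * \<psi> x) = (LINT y|lborel. b y * attenuate a (- n) \<psi> y)" .
qed

text \<open>
  The transport equation in the form needed for test functions: integration by parts against the
  exponential weight along a ray, with \<open>D\<close> the derivative of \<open>\<phi>\<close> in direction \<open>n\<close>.
\<close>

lemma attenuate_by_parts:
  fixes n :: "'a::euclidean_space"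
  assumes a: "0 < a" and n: "norm n = 1"
    and deriv: "\<And>x r. ((\<lambda>r. \<phi> (x + r *\<^sub>R n)) has_real_derivative D (x + r *\<^sub>R n)) (at r)"
    and D: "continuous_on UNIV D"
    and \<phi>: "continuous_on UNIV \<phi>"
    and B: "\<And>x. norm x \<ge> B \<Longrightarrow> \<phi> x = 0 \<and> D x = 0"
  shows "attenuate a (- n) D y = a * (attenuate a (- n) \<phi> y - \<phi> y)"
proof -
  define R where "R = \<bar>B\<bar> + norm y"
  have R0: "0 \<le> R" by (simp add: R_def)
  have far: "\<phi> (y + r *\<^sub>R n) = 0 \<and> D (y + r *\<^sub>R n) = 0" if "R \<le> r" for r
  proof (rule B)
    have "norm (r *\<^sub>R n) \<le> norm (y + r *\<^sub>R n) + norm y"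
      by (metis add_diff_cancel_left' norm_triangle_ineq4)
    then show "B \<le> norm (y + r *\<^sub>R n)"
      using that R0 n by (simp add: R_def)
  qed
  let ?f = "\<lambda>r. a * exp (- a * r) * D (y + r *\<^sub>R n)"
    and ?h = "\<lambda>r. a * (a * exp (- a * r) * \<phi> (y + r *\<^sub>R n))"
  have cont: "continuous_on S (\<lambda>r. D (y + r *\<^sub>R n))" "continuous_on S (\<lambda>r. \<phi> (y + r *\<^sub>R n))" for S
    by (auto intro!: continuous_on_compose2[OF D] continuous_on_compose2[OF \<phi>] continuous_intros)
  have ind: "exponential_density a r * h (y - r *\<^sub>R (- n)) = indicator {0..R} r *\<^sub>R (a * exp (- a * r) * h (y + r *\<^sub>R n))"
    if "\<And>r. R \<le> r \<Longrightarrow> h (y + r *\<^sub>R n) = 0" for h r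
    using that[of r] by (auto simp: exponential_density_def indicator_def mult.commute)
  have int: "integrable lborel (\<lambda>r. indicator {0..R} r *\<^sub>R ?f r)" "integrable lborel (\<lambda>r. indicator {0..R} r *\<^sub>R ?h r)"
    by (intro borel_integrable_compact compact_Icc continuous_intros cont)+
  have "attenuate a (- n) D y - a * attenuate a (- n) \<phi> y
     = (LINT r|lborel. indicator {0..R} r *\<^sub>R ?f r) - (LINT r|lborel. indicator {0..R} r *\<^sub>R ?h r)"
  proof -
    have "attenuate a (- n) D y = (LINT r|lborel. indicator {0..R} r *\<^sub>R ?f r)"
      unfolding attenuate_def using far by (intro Bochner_Integration.integral_cong ind) auto
    moreover have "attenuate a (- n) \<phi> y = (LINT r|lborel. indicator {0..R} r *\<^sub>R (a * exp (- a * r) * \<phi> (y + r *\<^sub>R n)))"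
      unfolding attenuate_def using far by (intro Bochner_Integration.integral_cong ind) auto
    then have "a * attenuate a (- n) \<phi> y = (LINT r|lborel. indicator {0..R} r *\<^sub>R ?h r)"
      by (simp add: mult.left_commute)
    ultimately show ?thesis by simp
  qed
  also have "\<dots> = (LINT r|lborel. indicator {0..R} r *\<^sub>R (?f r - ?h r))"
    using int by (simp add: Bochner_Integration.integral_diff[symmetric] right_diff_distrib del: Bochner_Integration.integral_diff)
  also have "\<dots> = a * exp (- a * R) * \<phi> (y + R *\<^sub>R n) - a * exp (- a * 0) * \<phi> (y + 0 *\<^sub>R n)"
    using R0
  proof (rule integral_FTC_Icc)
    fix r
    have "((\<lambda>r. a * exp (- a * r) * \<phi> (y + r *\<^sub>R n)) has_real_derivative ?f r - ?h r) (at r)"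
      by (auto intro!: derivative_eq_intros deriv simp: algebra_simps)
    then show "((\<lambda>r. a * exp (- a * r) * \<phi> (y + r *\<^sub>R n)) has_vector_derivative ?f r - ?h r) (at r within {0..R})"
      by (simp add: has_real_derivative_iff_has_vector_derivative[symmetric] has_field_derivative_at_within)
  qed (auto intro!: continuous_intros cont)
  also have "\<dots> = - a * \<phi> y"
    using far[of R] by simp
  finally show ?thesis by (simp add: algebra_simps)
qed

text \<open>
  From inside a set of diameter \<open>D\<close>, a flight longer than \<open>D\<close> leaves the set; this has probability
  \<open>exp (- a D)\<close>.  The resulting gap below 1 is what makes both the uniqueness argument strict and a
  constant supersolution available.
\<close>

lemma attenuate_indicator_le:
  fixes n :: "'a::euclidean_space"
  assumes a: "0 < a" and n: "norm n = 1" and [measurable]: "S \<in> sets borel"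
    and x: "x \<in> S" and D: "0 \<le> D" "\<And>y. y \<in> S \<Longrightarrow> dist x y \<le> D"
  shows "attenuate a n (indicator S) x \<le> 1 - exp (- a * D)"
proof -
  have "attenuate a n (indicator S) x = enn2real (\<integral>\<^sup>+r. ennreal (exponential_density a r * indicator S (x - r *\<^sub>R n)) \<partial>lborel)"
    unfolding attenuate_def by (rule integral_eq_nn_integral) (auto intro!: AE_I2 mult_nonneg_nonneg exponential_density_nonneg a)
  moreover have "(\<integral>\<^sup>+r. ennreal (exponential_density a r * indicator S (x - r *\<^sub>R n)) \<partial>lborel)
     \<le> (\<integral>\<^sup>+r. ennreal (exponential_density a r) * indicator {..D} r \<partial>lborel)"
  proof (rule nn_integral_mono)
    fix r
    have "r \<le> D" if "x - r *\<^sub>R n \<in> S"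
      using D(2)[OF that] n by (simp add: dist_norm)
    then show "ennreal (exponential_density a r * indicator S (x - r *\<^sub>R n)) \<le> ennreal (exponential_density a r) * indicator {..D} r"
      by (auto simp: indicator_def)
  qed
  moreover have "(\<integral>\<^sup>+r. ennreal (exponential_density a r) * indicator {..D} r \<partial>lborel) = ennreal (1 - exp (- a * D))"
    using nn_integral_erlang_density[OF a, of 0 D] D(1) by (simp add: erlang_CDF_0)
  ultimately show ?thesis
    using a D(1) by (simp add: enn2real_leI)
qed

section \<open>The Planck emission\<close>

context
  fixes h c k :: real
  assumes pos: "h > 0" "c > 0" "k > 0"
begin

lemma planck_nonneg:
  assumes "\<nu> > 0" "T \<ge> 0"
  shows "0 \<le> planck h c k \<nu> T"
  using assms pos by (auto simp: planck_def)

lemma planck_less: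
  assumes "\<nu> > 0" "0 \<le> S" "S < T"
  shows "planck h c k \<nu> S < planck h c k \<nu> T"
proof (cases "S = 0")
  case True
  then show ?thesis
    using assms pos by (auto simp: planck_def intro!: divide_pos_pos mult_pos_pos)
next
  case False
  then have "h * \<nu> / (k * T) < h * \<nu> / (k * S)"
    using assms pos by (intro divide_strict_left_mono mult_strict_left_mono mult_pos_pos) auto
  then have "1 / (exp (h * \<nu> / (k * S)) - 1) < 1 / (exp (h * \<nu> / (k * T)) - 1)"
    using assms pos False by (intro divide_strict_left_mono mult_pos_pos) auto
  then show ?thesis
    using assms pos False
    by (simp only: planck_def if_False less_imp_neq[THEN not_sym, of 0 T] le_less_trans[of 0 S T] simp_thms)
       (intro mult_strict_left_mono divide_pos_pos mult_pos_pos zero_less_power; simp)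
qed

lemma planck_mono:
  assumes "\<nu> > 0" "0 \<le> S" "S \<le> T"
  shows "planck h c k \<nu> S \<le> planck h c k \<nu> T"
  using planck_less[OF assms(1,2), of T] assms(3) by (cases "S = T") auto

lemma planck_le_linear:
  assumes "\<nu> > 0" "T \<ge> 0"
  shows "planck h c k \<nu> T \<le> 2 * k * \<nu>\<^sup>2 / c\<^sup>2 * T"
proof (cases "T = 0")
  case False
  then have T: "T > 0" using assms by simp
  let ?x = "h * \<nu> / (k * T)"
  have x: "?x > 0" using T assms pos by simp
  have "1 / (exp ?x - 1) \<le> 1 / ?x"
    using exp_ge_add_one_self[of ?x] x by (intro divide_left_mono mult_pos_pos) (auto simp del: exp_ge_add_one_self)
  then have "planck h c k \<nu> T \<le> 2 * h * \<nu> ^ 3 / c\<^sup>2 * (1 / ?x)"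
    unfolding planck_def using False assms pos by (simp only: if_False) (intro mult_left_mono, auto)
  also have "\<dots> = 2 * k * \<nu>\<^sup>2 / c\<^sup>2 * T"
    using T assms pos by (simp add: field_simps power2_eq_square power3_eq_cube)
  finally show ?thesis .
qed (simp add: planck_def)

lemma continuous_on_planck:
  assumes \<nu>: "\<nu> > 0"
  shows "continuous_on {0..} (planck h c k \<nu>)"
proof -
  have "(planck h c k \<nu> \<longlongrightarrow> planck h c k \<nu> T) (at T within {0..})" if "T \<ge> 0" for T
  proof (cases "T = 0")
    case True
    have "(planck h c k \<nu> \<longlongrightarrow> 0) (at 0 within {0..})"
    proof (rule tendsto_sandwich)
      show "\<forall>\<^sub>F T in at 0 within {0..}. 0 \<le> planck h c k \<nu> T"
        using planck_nonneg[OF \<nu>] by (auto simp: eventually_at_filter)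
      show "\<forall>\<^sub>F T in at 0 within {0..}. planck h c k \<nu> T \<le> 2 * k * \<nu>\<^sup>2 / c\<^sup>2 * T"
        using planck_le_linear[OF \<nu>] by (auto simp: eventually_at_filter)
      show "((\<lambda>T. 2 * k * \<nu>\<^sup>2 / c\<^sup>2 * T) \<longlongrightarrow> 0) (at 0 within {0..})"
        using pos by (auto intro!: tendsto_eq_intros)
    qed simp
    then show ?thesis using True by (simp add: planck_def)
  next
    case False
    then have T: "T > 0" using that by simp
    have "((\<lambda>T. 2 * h * \<nu> ^ 3 / c\<^sup>2 * (1 / (exp (h * \<nu> / (k * T)) - 1))) \<longlongrightarrow> planck h c k \<nu> T) (at T)"
      unfolding planck_def using T \<nu> pos by (auto intro!: tendsto_eq_intros)
    moreover have "\<forall>\<^sub>F T in at T. 2 * h * \<nu> ^ 3 / c\<^sup>2 * (1 / (exp (h * \<nu> / (k * T)) - 1)) = planck h c k \<nu> T"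
      using order_tendstoD(1)[OF tendsto_ident_at T] by eventually_elim (simp add: planck_def)
    ultimately have "(planck h c k \<nu> \<longlongrightarrow> planck h c k \<nu> T) (at T)"
      by (rule Lim_transform_eventually)
    then show ?thesis by (rule tendsto_within_subset) simp
  qed
  then show ?thesis by (simp add: continuous_on_def)
qed

text \<open>
  The factor \<open>1 / (exp x - 1)\<close> grows at least linearly in \<open>1 / x\<close>, by Bernoulli's inequality for
  \<open>exp (x / m)\<close>.  So the emission at temperature \<open>m\<close> dominates \<open>m\<close> times the emission at temperature
  1, uniformly in the frequency.
\<close>

lemma planck_superlinear:
  assumes \<nu>: "\<nu> > 0" and m: "m > 0"
  shows "real m * planck h c k \<nu> 1 \<le> planck h c k \<nu> (real m)"
proof -
  let ?x = "h * \<nu> / (k * real m)"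
  have x: "?x > 0" using assms pos by simp
  have "1 + real m * (exp ?x - 1) \<le> exp ?x ^ m"
    using Bernoulli_inequality[of "exp ?x - 1" m] x by simp
  also have "\<dots> = exp (h * \<nu> / k)"
    using m pos by (simp add: exp_of_nat_mult[symmetric])
  finally have le: "real m * (exp ?x - 1) \<le> exp (h * \<nu> / k) - 1" by simp
  have "real m / (exp (h * \<nu> / k) - 1) \<le> real m / (real m * (exp ?x - 1))"
    using le x m \<nu> pos by (intro divide_left_mono mult_pos_pos) auto
  also have "\<dots> = 1 / (exp ?x - 1)" using m by simp
  finally have "2 * h * \<nu> ^ 3 / c\<^sup>2 * (real m / (exp (h * \<nu> / k) - 1)) \<le> 2 * h * \<nu> ^ 3 / c\<^sup>2 * (1 / (exp ?x - 1))"
    using \<nu> pos by (intro mult_left_mono) auto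
  then show ?thesis
    using m by (simp add: planck_def mult_ac)
qed

text \<open>
  Boundedness in the frequency transfers the integrability of \<open>\<alpha>\<close> to the emitted power;
  it rests on \<open>exp x - 1 \<ge> x\<^sup>3 / 27\<close>.
\<close>

lemma planck_bounded: "\<exists>K. \<forall>\<nu>>0. planck h c k \<nu> T \<le> K" if "T \<ge> 0"
proof (cases "T = 0")
  case True
  then show ?thesis by (auto simp: planck_def intro!: exI[of _ 0])
next
  case False
  then have T: "T > 0" using that by simp
  define \<beta> where "\<beta> = h / (k * T)"
  have \<beta>: "\<beta> > 0" using T pos by (simp add: \<beta>_def)
  have "planck h c k \<nu> T \<le> 2 * h / c\<^sup>2 * (27 / \<beta> ^ 3)" if \<nu>: "\<nu> > 0" for \<nu>
  proof -
    let ?x = "\<beta> * \<nu>"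
    have x: "?x > 0" using \<beta> \<nu> by simp
    have "?x ^ 3 / 27 \<le> (1 + ?x / 3) ^ 3 - 1"
    proof -
      have "(1 + ?x / 3) ^ 3 - 1 = ?x + ?x\<^sup>2 / 3 + ?x ^ 3 / 27"
        by (simp add: power2_eq_square power3_eq_cube field_simps)
      then show ?thesis using x by simp
    qed
    also have "\<dots> \<le> exp (?x / 3) ^ 3 - 1"
      using x exp_ge_add_one_self[of "?x / 3"] by (intro diff_right_mono power_mono) (auto simp del: exp_ge_add_one_self)
    also have "\<dots> = exp ?x - 1"
      by (simp add: exp_of_nat_mult[symmetric])
    finally have "1 / (exp ?x - 1) \<le> 1 / (?x ^ 3 / 27)"
      using x by (intro divide_left_mono mult_pos_pos) auto
    then have "2 * h * \<nu> ^ 3 / c\<^sup>2 * (1 / (exp ?x - 1)) \<le> 2 * h * \<nu> ^ 3 / c\<^sup>2 * (1 / (?x ^ 3 / 27))"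
      using \<nu> pos by (intro mult_left_mono) auto
    also have "\<dots> = 2 * h / c\<^sup>2 * (27 / \<beta> ^ 3)"
      using \<nu> \<beta> by (simp add: field_simps)
    finally show ?thesis
      using T by (simp add: planck_def \<beta>_def mult_ac)
  qed
  then show ?thesis by blast
qed

text \<open>
  With \<open>x\<close> proportional to \<open>\<nu>\<close>, the bound \<open>x / (exp x - 1) \<le> 2 exp (- x / 2)\<close> leaves a multiple of
  an Erlang density.
\<close>

lemma integrable_planck:
  assumes T: "T \<ge> 0"
  shows "integrable freq (\<lambda>\<nu>. planck h c k \<nu> T)"
proof (cases "T = 0")
  case True
  then show ?thesis by (simp add: planck_def)
next
  case False
  then have T: "T > 0" using assms by simp
  define \<beta> where "\<beta> = h / (k * T)"
  have \<beta>: "\<beta> > 0" using T pos by (simp add: \<beta>_def)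
  define C where "C = 2 * h / c\<^sup>2 * (2 / \<beta>) * (2 * (2 / \<beta>) ^ 3)"
  have bound: "planck h c k \<nu> T \<le> C * erlang_density 2 (\<beta> / 2) \<nu>" if \<nu>: "\<nu> > 0" for \<nu>
  proof -
    let ?x = "\<beta> * \<nu>"
    have x: "?x > 0" using \<beta> \<nu> by simp
    have "?x * exp (?x / 2) \<le> 2 * (exp (?x / 2) - 1) * exp (?x / 2)"
      using exp_ge_add_one_self[of "?x / 2"]
      by (intro mult_right_mono) (auto simp del: exp_ge_add_one_self)
    also have "\<dots> = 2 * (exp ?x - exp (?x / 2))"
      by (simp add: algebra_simps exp_add[symmetric])
    also have "\<dots> \<le> 2 * (exp ?x - 1)"
      using x by simp
    finally have le: "?x * exp (?x / 2) / 2 \<le> exp ?x - 1" by simp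
    have "1 / (exp ?x - 1) \<le> 1 / (?x * exp (?x / 2) / 2)"
      using le x by (intro divide_left_mono mult_pos_pos) auto
    then have "1 / (exp ?x - 1) \<le> 2 / (?x * exp (?x / 2))" by simp
    then have "2 * h * \<nu> ^ 3 / c\<^sup>2 * (1 / (exp ?x - 1)) \<le> 2 * h * \<nu> ^ 3 / c\<^sup>2 * (2 / (?x * exp (?x / 2)))"
      using \<nu> pos by (intro mult_left_mono) auto
    also have "\<dots> = C * erlang_density 2 (\<beta> / 2) \<nu>"
      using \<nu> \<beta> pos
      by (simp add: erlang_density_def C_def exp_minus field_simps power2_eq_square power3_eq_cube fact_numeral)
    finally show ?thesis
      using T by (simp add: planck_def \<beta>_def mult_ac)
  qed
  show ?thesis
  proof (rule Bochner_Integration.integrable_bound)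
    have "integrable lborel (\<lambda>\<nu>. indicator {0<..} \<nu> *\<^sub>R (C * erlang_density 2 (\<beta> / 2) \<nu>))"
      using integral_erlang_density(1)[of "\<beta> / 2" 2] \<beta> by (intro integrable_mult_indicator) auto
    then show "integrable freq (\<lambda>\<nu>. C * erlang_density 2 (\<beta> / 2) \<nu>)"
      by (subst integrable_restrict_space) auto
    show "(\<lambda>\<nu>. planck h c k \<nu> T) \<in> borel_measurable freq"
      unfolding planck_def by (intro measurable_restrict_space1) measurable
    show "AE \<nu> in freq. norm (planck h c k \<nu> T) \<le> norm (C * erlang_density 2 (\<beta> / 2) \<nu>)"
      using bound planck_nonneg T
      by (intro AE_I2) (auto simp: space_restrict_space intro: order_trans[OF _ abs_ge_self])
  qed
qed

end

lemma measurable_planck [measurable (raw)]: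
  assumes [measurable]: "N \<in> borel_measurable M" "T \<in> borel_measurable M"
  shows "(\<lambda>x. planck h c k (N x) (T x)) \<in> borel_measurable M"
  unfolding planck_def by measurable

section \<open>The surface measure of the sphere\<close>

lemma measurable_normalize: "(\<lambda>x::real ^ 3. x /\<^sub>R norm x) \<in> restrict_space lborel (ball 0 1 - {0}) \<rightarrow>\<^sub>M restrict_space borel (sphere 0 1)"
  by (intro measurable_restrict_space2 measurable_restrict_space1) (auto simp: space_restrict_space)

lemma space_sphere_surface [simp]: "space sphere_surface = sphere 0 1"
  by (simp add: sphere_surface_def space_scale_measure space_restrict_space)

lemma sets_sphere_surface [measurable_cong]: "sets sphere_surface = sets (restrict_space borel (sphere 0 1))"
  by (simp add: sphere_surface_def)

lemma emeasure_sphere_surface: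
  "emeasure sphere_surface (space sphere_surface) = ennreal (3 * measure lborel (ball (0 :: real ^ 3) 1))"
proof -
  have "emeasure sphere_surface (space sphere_surface) = 3 * emeasure lborel (ball (0 :: real ^ 3) 1 - {0})"
    unfolding space_sphere_surface
    using measurable_space[OF measurable_normalize]
    by (subst sphere_surface_def, subst emeasure_scale_measure, subst emeasure_distr[OF measurable_normalize])
       (auto simp: emeasure_restrict_space sets_restrict_space_iff space_restrict_space
         intro!: arg_cong[where f="\<lambda>A. 3 * emeasure lborel A"])
  also have "\<dots> = 3 * emeasure lborel (ball (0 :: real ^ 3) 1)"
    by (subst emeasure_Diff_null_set) (auto simp: null_sets_def)
  also have "\<dots> = ennreal (3 * measure lborel (ball (0 :: real ^ 3) 1))"
    using emeasure_lborel_ball_finite[of "0 :: real ^ 3" 1]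
    by (subst emeasure_eq_ennreal_measure) (auto simp: ennreal_mult ennreal_numeral)
  finally show ?thesis .
qed

lemma finite_sphere_surface: "finite_measure sphere_surface"
  by (rule finite_measureI) (simp only: emeasure_sphere_surface infinity_ennreal_def ennreal_neq_top not_False_eq_True)

lemma sphere_surface_pos: "0 < measure sphere_surface (space sphere_surface)"
  using measure_eq_emeasure_eq_ennreal[OF _ emeasure_sphere_surface] content_ball_pos[of 1 "0 :: real ^ 3"]
  by simp

section \<open>Rays in a convex domain\<close>

lemma backward_ray:
  fixes \<Omega> :: "(real ^ 3) set"
  assumes \<Omega>: "open \<Omega>" "bounded \<Omega>" "convex \<Omega>" and x: "x \<in> \<Omega>" and n: "norm n = 1"
  obtains s where "s > 0" "back_dist \<Omega> x n = s" "back_point \<Omega> x n = x - s *\<^sub>R n"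
    "\<And>r. 0 \<le> r \<Longrightarrow> x - r *\<^sub>R n \<in> \<Omega> \<longleftrightarrow> r < s"
proof -
  have int: "interior \<Omega> = \<Omega>" using \<Omega>(1) by (rule interior_open)
  have "- n \<noteq> 0" using n by auto
  have "\<exists>s. 0 < s \<and> x + s *\<^sub>R (- n) \<in> frontier \<Omega> \<and> (\<forall>e. 0 \<le> e \<and> e < s \<longrightarrow> x + e *\<^sub>R (- n) \<in> interior \<Omega>)"
  proof (rule ray_to_frontier[OF \<Omega>(2), of x "- n"])
    show "x \<in> interior \<Omega>" using x int by simp
    show "- n \<noteq> 0" by fact
  qed blast
  then obtain s where s: "0 < s" "x + s *\<^sub>R (- n) \<in> frontier \<Omega>"
    and in_lt: "\<And>e. 0 \<le> e \<Longrightarrow> e < s \<Longrightarrow> x + e *\<^sub>R (- n) \<in> interior \<Omega>"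
    by blast
  have not_mem: "x - t *\<^sub>R n \<notin> \<Omega>" if "x - t *\<^sub>R n \<in> frontier \<Omega>" for t
    using that int by (auto simp: frontier_def)
  have beyond: "x - t *\<^sub>R n \<notin> closure \<Omega>" if "s < t" for t
  proof
    assume cl: "x - t *\<^sub>R n \<in> closure \<Omega>"
    have "(x - t *\<^sub>R n) - (1 - s / t) *\<^sub>R ((x - t *\<^sub>R n) - x) \<in> interior \<Omega>"
    proof (rule mem_interior_closure_convex_shrink[OF \<Omega>(3) _ cl])
      show "x \<in> interior \<Omega>" using x int by simp
      show "0 < 1 - s / t" "1 - s / t \<le> 1" using that s(1) by simp_all
    qed
    also have "(x - t *\<^sub>R n) - (1 - s / t) *\<^sub>R ((x - t *\<^sub>R n) - x) = x - s *\<^sub>R n"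
      using that s(1) by (simp add: algebra_simps)
    finally show False
      using not_mem[of s] s(2) int by simp
  qed
  have mem: "x - r *\<^sub>R n \<in> \<Omega> \<longleftrightarrow> r < s" if "0 \<le> r" for r
  proof (cases r s rule: linorder_cases)
    case greater
    then show ?thesis using beyond[of r] closure_subset[of \<Omega>] by auto
  qed (use in_lt[OF that] int not_mem[of s] s in auto)
  have point: "back_point \<Omega> x n = x - s *\<^sub>R n"
    unfolding back_point_def
  proof (rule the_equality)
    show "x - s *\<^sub>R n \<in> frontier \<Omega> \<and> (\<exists>t\<ge>0. x - s *\<^sub>R n = x - t *\<^sub>R n)"
      using s by (auto intro!: exI[of _ s])
    fix y assume "y \<in> frontier \<Omega> \<and> (\<exists>t\<ge>0. y = x - t *\<^sub>R n)"
    then obtain t where t: "t \<ge> 0" "y = x - t *\<^sub>R n" "y \<in> frontier \<Omega>" by auto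
    then have "\<not> t < s" using mem[of t] not_mem by auto
    moreover have "\<not> s < t" using beyond[of t] t by (auto simp: frontier_def)
    ultimately show "y = x - s *\<^sub>R n" using t by simp
  qed
  moreover have "back_dist \<Omega> x n = s"
    using s n by (simp add: back_dist_def point dist_norm)
  ultimately show ?thesis using that s mem by blast
qed

lemma integral_exponential_density_tail:
  assumes a: "0 < a" and s: "0 \<le> s"
  shows "(LINT r|lborel. exponential_density a r * indicator {s..} r) = exp (- a * s)"
proof -
  have int: "integrable lborel (\<lambda>r. exponential_density a r * indicator A r)" if "A \<in> sets borel" for A
    using integrable_mult_indicator[of A lborel "exponential_density a"] that integral_erlang_density(1)[OF a, of 0]
    by (simp add: mult.commute)
  have "(LINT r|lborel. exponential_density a r * indicator {..s} r)
      = enn2real (\<integral>\<^sup>+r. ennreal (exponential_density a r * indicator {..s} r) \<partial>lborel)"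
    by (rule integral_eq_nn_integral) (auto intro!: AE_I2 mult_nonneg_nonneg exponential_density_nonneg a)
  also have "(\<integral>\<^sup>+r. ennreal (exponential_density a r * indicator {..s} r) \<partial>lborel)
      = (\<integral>\<^sup>+r. ennreal (exponential_density a r) * indicator {..s} r \<partial>lborel)"
    by (intro nn_integral_cong) (auto simp: indicator_def)
  also have "\<dots> = ennreal (1 - exp (- a * s))"
    using nn_integral_erlang_density[OF a, of 0 s] s by (simp add: erlang_CDF_0)
  finally have head: "(LINT r|lborel. exponential_density a r * indicator {..s} r) = 1 - exp (- a * s)"
    using a s by simp
  have "(LINT r|lborel. exponential_density a r * indicator {s..} r) = (LINT r|lborel. exponential_density a r - exponential_density a r * indicator {..s} r)"
    using AE_lborel_singleton[of s]
    by (intro integral_cong_AE) (auto simp: indicator_def elim!: eventually_mono)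
  also have "\<dots> = exp (- a * s)"
    using head int[of "{..s}"] integral_erlang_density[OF a, of 0] by simp
  finally show ?thesis .
qed

text \<open>
  Substituting the distance \<open>r = s - \<xi>\<close> to the observer turns the ray integral into an attenuated
  average of the emission cut off outside the domain.  The temperature is known to be measurable only
  inside the domain; the ray meets the boundary at the single parameter \<open>r = s\<close>, which does not
  affect the integral.
\<close>

lemma intensity_eq:
  assumes \<Omega>: "open \<Omega>" "bounded \<Omega>" "convex \<Omega>" and x: "x \<in> \<Omega>" and n: "norm n = 1"
    and a: "\<alpha> \<nu> > 0"
    and T: "T \<in> borel_measurable (restrict_space borel \<Omega>)"
  shows "intensity \<Omega> h c k \<alpha> g T \<nu> x n =
    g \<nu> n * exp (- \<alpha> \<nu> * back_dist \<Omega> x n) + attenuate (\<alpha> \<nu>) n (\<lambda>z. indicator \<Omega> z * planck h c k \<nu> (T z)) x"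
proof -
  obtain s where s: "s > 0" "back_dist \<Omega> x n = s" "back_point \<Omega> x n = x - s *\<^sub>R n"
    and mem: "\<And>r. 0 \<le> r \<Longrightarrow> x - r *\<^sub>R n \<in> \<Omega> \<longleftrightarrow> r < s"
    using backward_ray[OF \<Omega> x n] by blast
  have [measurable]: "\<Omega> \<in> sets borel" using \<Omega>(1) by simp
  have T0 [measurable]: "(\<lambda>z. indicator \<Omega> z * T z) \<in> borel_measurable borel"
    using T by (subst (asm) borel_measurable_restrict_space_iff) auto
  let ?B = "\<lambda>r. planck h c k \<nu> (T (x - r *\<^sub>R n))"
  let ?F = "\<lambda>r. indicator {0..s} r * (exp (- \<alpha> \<nu> * r) * ?B r)"
  let ?G = "\<lambda>r. exponential_density (\<alpha> \<nu>) r * (indicator \<Omega> (x - r *\<^sub>R n) * ?B r)"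
  have G [measurable]: "?G \<in> borel_measurable borel"
  proof -
    have "?G = (\<lambda>r. exponential_density (\<alpha> \<nu>) r * (indicator \<Omega> (x - r *\<^sub>R n) * planck h c k \<nu> (indicator \<Omega> (x - r *\<^sub>R n) * T (x - r *\<^sub>R n))))"
      by (auto simp: indicator_def)
    also have "\<dots> \<in> borel_measurable borel"
      using measurable_compose[OF _ T0, of "\<lambda>r. x - r *\<^sub>R n" borel] by measurable
    finally show ?thesis .
  qed
  \<comment> \<open>The value at \<open>r = s\<close> is kept apart because \<open>T\<close> is evaluated on the boundary there.\<close>
  have FG: "\<alpha> \<nu> * ?F r = (if r = s then \<alpha> \<nu> * ?F s else ?G r)" for r
    using mem[of r] by (auto simp: exponential_density_def indicator_def mult_ac)
  have "(LINT \<xi>:{0..s}|lborel. exp (- \<alpha> \<nu> * (s - \<xi>)) * planck h c k \<nu> (T (x - s *\<^sub>R n + \<xi> *\<^sub>R n)))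
      = (LINT r|lborel. ?F r)"
    unfolding set_lebesgue_integral_def
    by (subst lborel_integral_real_affine[where c="-1" and t=s])
       (auto intro!: Bochner_Integration.integral_cong simp: indicator_def algebra_simps)
  then have "\<alpha> \<nu> * (LINT \<xi>:{0..s}|lborel. exp (- \<alpha> \<nu> * (s - \<xi>)) * planck h c k \<nu> (T (x - s *\<^sub>R n + \<xi> *\<^sub>R n)))
      = (LINT r|lborel. \<alpha> \<nu> * ?F r)"
    by simp
  also have "\<dots> = (LINT r|lborel. (if r = s then \<alpha> \<nu> * ?F s else ?G r))"
    by (rule Bochner_Integration.integral_cong[OF refl FG])
  also have "\<dots> = (LINT r|lborel. ?G r)"
  proof (rule integral_cong_AE)
    show "AE r in lborel. (if r = s then \<alpha> \<nu> * ?F s else ?G r) = ?G r"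
      using AE_lborel_singleton[of s] by eventually_elim simp
  qed measurable
  finally show ?thesis
    by (simp add: intensity_def s attenuate_def)
qed

section \<open>Test functions\<close>

lemma test_function_gradient:
  assumes \<phi>: "test_function \<Omega> \<phi>" and G: "\<And>x. GDERIV \<phi> x :> G x"
  shows "continuous_on UNIV \<phi>" "continuous_on UNIV G"
    and "\<exists>K. compact K \<and> K \<subseteq> \<Omega> \<and> (\<forall>x. x \<notin> K \<longrightarrow> \<phi> x = 0 \<and> G x = 0)"
proof -
  have "Ck 0 \<phi>" using \<phi> by (auto simp only: test_function_def)
  then show "continuous_on UNIV \<phi>" by simp
  have "Ck (Suc 0) \<phi>" using \<phi> by (auto simp only: test_function_def)
  then obtain G' where G': "\<And>x. GDERIV \<phi> x :> G' x" "\<And>i. continuous_on UNIV (\<lambda>x. G' x $ i)"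
    by auto
  have uniq: "A = B" if "GDERIV \<phi> x :> A" "GDERIV \<phi> x :> B" for A B x
  proof -
    have "(\<lambda>h. h \<bullet> A) = (\<lambda>h. h \<bullet> B)"
      using that unfolding gderiv_def by (rule has_derivative_unique)
    then show ?thesis by (metis inner_commute vector_eq_ldot)
  qed
  have "G = G'" using uniq G G'(1) by blast
  moreover have "continuous_on UNIV (\<lambda>x. \<chi> i. G' x $ i)"
    by (intro continuous_on_vec_lambda G')
  ultimately show "continuous_on UNIV G" by simp
  obtain K where K: "compact K" "K \<subseteq> \<Omega>" "\<And>x. x \<notin> K \<Longrightarrow> \<phi> x = 0"
    using \<phi> by (auto simp: test_function_def)
  have "G x = 0" if "x \<notin> K" for x
  proof -
    have "((\<lambda>x. 0) has_derivative (\<lambda>h. h \<bullet> G x)) (at x)"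
      using G[of x] K that compact_imp_closed[OF K(1)] unfolding gderiv_def
      by (elim has_derivative_transform_within_open[where s="- K"]) auto
    then have "GDERIV (\<lambda>x. 0) x :> G x" by (simp add: gderiv_def)
    moreover have "((\<lambda>x. 0) has_derivative (\<lambda>h. h \<bullet> 0)) (at x)" by simp
    ultimately have "(\<lambda>h. h \<bullet> G x) = (\<lambda>h. h \<bullet> 0)"
      unfolding gderiv_def by (rule has_derivative_unique)
    then show ?thesis by (metis inner_commute vector_eq_ldot)
  qed
  then show "\<exists>K. compact K \<and> K \<subseteq> \<Omega> \<and> (\<forall>x. x \<notin> K \<longrightarrow> \<phi> x = 0 \<and> G x = 0)"
    using K by blast
qed

lemma integrable_continuous_compact_support:
  fixes f :: "'a::euclidean_space \<Rightarrow> 'b::{banach, second_countable_topology}"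
  assumes "continuous_on UNIV f" "compact K" "\<And>x. x \<notin> K \<Longrightarrow> f x = 0"
  shows "integrable lborel f"
proof -
  have "integrable lborel (\<lambda>x. indicator K x *\<^sub>R f x)"
    using assms by (intro borel_integrable_compact) (auto intro: continuous_on_subset)
  also have "(\<lambda>x. indicator K x *\<^sub>R f x) = f"
    using assms(3) by (auto simp: indicator_def)
  finally show ?thesis .
qed

section \<open>The radiation field of a bounded temperature\<close>

abbreviation ray_measure :: "(real \<times> (real ^ 3)) measure" where
  "ray_measure \<equiv> freq \<Otimes>\<^sub>M sphere_surface"

interpretation sphere: finite_measure sphere_surface
  by (rule finite_sphere_surface)

lemma sigma_finite_freq: "sigma_finite_measure freq"
  by (rule sigma_finite_measure_restrict_space) (auto simp: lborel.sigma_finite_measure_axioms)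

interpretation ray: pair_sigma_finite freq sphere_surface
  by (rule pair_sigma_finite.intro[OF sigma_finite_freq sphere.sigma_finite_measure_axioms])

lemma sigma_finite_ray: "sigma_finite_measure ray_measure"
  by (rule ray.sigma_finite_measure_axioms)

interpretation ray_pos: pair_sigma_finite ray_measure "lborel :: (real ^ 3) measure"
  by (rule pair_sigma_finite.intro[OF ray.sigma_finite_measure_axioms lborel.sigma_finite_measure_axioms])

lemma space_ray: "p \<in> space ray_measure \<longleftrightarrow> fst p > 0 \<and> norm (snd p) = 1"
  by (cases p) (auto simp: space_pair_measure space_restrict_space)

lemma measurable_snd_ray [measurable]: "snd \<in> ray_measure \<rightarrow>\<^sub>M borel"
proof -
  have "(\<lambda>n. n) \<in> sphere_surface \<rightarrow>\<^sub>M borel"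
    by (subst measurable_cong_sets[OF sets_sphere_surface refl]) (rule measurable_restrict_space1, simp)
  then show ?thesis by (rule measurable_compose[OF measurable_snd])
qed

lemma measurable_fst_ray [measurable]: "fst \<in> ray_measure \<rightarrow>\<^sub>M borel"
proof -
  have "(\<lambda>\<nu>. \<nu>) \<in> freq \<rightarrow>\<^sub>M borel"
    by (rule measurable_restrict_space1) simp
  then show ?thesis by (rule measurable_compose[OF measurable_fst])
qed

locale medium =
  fixes \<Omega> :: "(real ^ 3) set" and h c k :: real and \<alpha> :: "real \<Rightarrow> real" and g :: "real \<Rightarrow> real ^ 3 \<Rightarrow> real"
  assumes constants: "h > 0" "c > 0" "k > 0"
    and domain: "open \<Omega>" "bounded \<Omega>" "convex \<Omega>"
    and \<alpha>_pos: "\<And>\<nu>. \<nu> > 0 \<Longrightarrow> \<alpha> \<nu> > 0"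
    and integrable_\<alpha>: "integrable freq \<alpha>"
    and g_nonneg: "\<And>\<nu> n. \<nu> > 0 \<Longrightarrow> n \<in> sphere 0 1 \<Longrightarrow> g \<nu> n \<ge> 0"
    and integrable_g: "integrable ray_measure (\<lambda>(\<nu>, n). g \<nu> n)"
    and integrable_\<alpha>2_g: "integrable ray_measure (\<lambda>(\<nu>, n). (\<alpha> \<nu>)\<^sup>2 * g \<nu> n)"
begin

abbreviation "B \<equiv> planck h c k"

lemma \<Omega>_measurable [measurable]: "\<Omega> \<in> sets borel"
  using domain(1) by simp

lemma measurable_\<alpha>_fst [measurable]: "(\<lambda>p. \<alpha> (fst p)) \<in> borel_measurable ray_measure"
  by (rule measurable_compose[OF measurable_fst borel_measurable_integrable[OF integrable_\<alpha>]])

lemma measurable_g [measurable]: "(\<lambda>p. g (fst p) (snd p)) \<in> borel_measurable ray_measure"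
  using borel_measurable_integrable[OF integrable_g] by (simp add: case_prod_unfold)

text \<open>
  The incoming boundary radiation \<open>g\<close> is produced by filling the exterior of the domain with the same
  absorbing medium and letting it emit the constant \<open>g\<close> for the given frequency and direction: the
  part of an infinite backward ray beyond the exit point at distance \<open>s\<close> then contributes exactly
  \<open>g exp (- \<alpha> s)\<close>.  A ray is a pair of a frequency and a direction.
\<close>

definition source :: "(real ^ 3 \<Rightarrow> real) \<Rightarrow> real \<times> (real ^ 3) \<Rightarrow> real ^ 3 \<Rightarrow> real" where
  "source T p z = (if z \<in> \<Omega> then B (fst p) (T z) else g (fst p) (snd p))"

definition field :: "(real ^ 3 \<Rightarrow> real) \<Rightarrow> real \<times> (real ^ 3) \<Rightarrow> real ^ 3 \<Rightarrow> real" where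
  "field T p x = attenuate (\<alpha> (fst p)) (snd p) (source T p) x"

text \<open>
  An integrable bound, uniform in space, for the source and the field of all temperatures up to \<open>C\<close>.
\<close>

definition ceiling_source :: "real \<Rightarrow> real \<times> (real ^ 3) \<Rightarrow> real" where
  "ceiling_source C p = g (fst p) (snd p) + B (fst p) C"

text \<open>
  Power absorbed minus power emitted at a point; the conservation law says that it vanishes.
\<close>

definition exchange :: "(real ^ 3 \<Rightarrow> real) \<Rightarrow> real ^ 3 \<Rightarrow> real" where
  "exchange T x = (\<integral>p. \<alpha> (fst p) * (field T p x - source T p x) \<partial>ray_measure)"

text \<open>
  The bounds are imposed on the whole space, so that measurability of expressions in \<open>T\<close> does not
  involve the domain.
\<close>

definition bounded_temp :: "real \<Rightarrow> (real ^ 3 \<Rightarrow> real) \<Rightarrow> bool" where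
  "bounded_temp C T \<longleftrightarrow> T \<in> borel_measurable borel \<and> (\<forall>x. 0 \<le> T x \<and> T x \<le> C)"

lemma integrable_\<alpha>_g: "integrable ray_measure (\<lambda>p. \<alpha> (fst p) * g (fst p) (snd p))"
proof (rule Bochner_Integration.integrable_bound)
  show "integrable ray_measure (\<lambda>p. g (fst p) (snd p) + (\<alpha> (fst p))\<^sup>2 * g (fst p) (snd p))"
    using integrable_g integrable_\<alpha>2_g by (simp add: case_prod_unfold)
  show "AE p in ray_measure. norm (\<alpha> (fst p) * g (fst p) (snd p)) \<le> norm (g (fst p) (snd p) + (\<alpha> (fst p))\<^sup>2 * g (fst p) (snd p))"
  proof (rule AE_I2)
    fix p assume "p \<in> space ray_measure"
    then have g0: "0 \<le> g (fst p) (snd p)" and \<alpha>0: "0 < \<alpha> (fst p)"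
      using g_nonneg \<alpha>_pos by (auto simp: space_ray)
    \<comment> \<open>The weight \<open>\<alpha>\<close> interpolates between the two weights 1 and \<open>\<alpha>\<^sup>2\<close>.\<close>
    have "0 \<le> (\<alpha> (fst p) - 1)\<^sup>2 + \<alpha> (fst p)" using \<alpha>0 by simp
    then have "\<alpha> (fst p) \<le> 1 + (\<alpha> (fst p))\<^sup>2" by (simp add: power2_eq_square algebra_simps)
    then have "\<alpha> (fst p) * g (fst p) (snd p) \<le> (1 + (\<alpha> (fst p))\<^sup>2) * g (fst p) (snd p)"
      using g0 by (rule mult_right_mono)
    then show "norm (\<alpha> (fst p) * g (fst p) (snd p)) \<le> norm (g (fst p) (snd p) + (\<alpha> (fst p))\<^sup>2 * g (fst p) (snd p))"
      using g0 \<alpha>0 by (simp add: distrib_right)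
  qed
qed measurable

lemma integrable_freq_ray:
  fixes f :: "real \<Rightarrow> real"
  assumes "integrable freq f"
  shows "integrable ray_measure (\<lambda>p. f (fst p))"
    and "(\<integral>p. f (fst p) \<partial>ray_measure) = measure sphere_surface (space sphere_surface) * (\<integral>\<nu>. f \<nu> \<partial>freq)"
proof -
  show int: "integrable ray_measure (\<lambda>p. f (fst p))"
    using integrable_mult_prod[OF sigma_finite_freq sphere.sigma_finite_measure_axioms assms, of "\<lambda>_. 1"]
    by (simp add: case_prod_unfold)
  show "(\<integral>p. f (fst p) \<partial>ray_measure) = measure sphere_surface (space sphere_surface) * (\<integral>\<nu>. f \<nu> \<partial>freq)"
    using ray.integral_fst'[OF int] by (simp add: mult.commute)
qed

lemma integrable_\<alpha>_B:
  assumes "T \<ge> 0"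
  shows "integrable freq (\<lambda>\<nu>. \<alpha> \<nu> * B \<nu> T)"
proof -
  obtain K where K: "\<And>\<nu>. \<nu> > 0 \<Longrightarrow> B \<nu> T \<le> K"
    using planck_bounded[OF constants assms] by blast
  note [measurable] = borel_measurable_integrable[OF integrable_\<alpha>] borel_measurable_integrable[OF integrable_planck[OF constants assms]]
  show ?thesis
  proof (rule Bochner_Integration.integrable_bound)
    show "integrable freq (\<lambda>\<nu>. \<alpha> \<nu> * K)" using integrable_\<alpha> by simp
    show "AE \<nu> in freq. norm (\<alpha> \<nu> * B \<nu> T) \<le> norm (\<alpha> \<nu> * K)"
    proof (rule AE_I2)
      fix \<nu> :: real assume "\<nu> \<in> space freq"
      then have \<nu>: "\<nu> > 0" by (simp add: space_restrict_space)
      show "norm (\<alpha> \<nu> * B \<nu> T) \<le> norm (\<alpha> \<nu> * K)"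
        using K[OF \<nu>] planck_nonneg[OF constants \<nu> assms] \<alpha>_pos[OF \<nu>]
        by (simp add: abs_mult mult_left_mono)
    qed
  qed measurable
qed

lemma emission_eq:
  assumes "T \<ge> 0"
  shows "(\<integral>p. \<alpha> (fst p) * B (fst p) T \<partial>ray_measure) = measure sphere_surface (space sphere_surface) * emission h c k \<alpha> T"
  unfolding emission_def by (rule integrable_freq_ray(2)[OF integrable_\<alpha>_B[OF assms]])

lemma integrable_ceiling_source:
  assumes "C \<ge> 0"
  shows "integrable ray_measure (ceiling_source C)"
    and "integrable ray_measure (\<lambda>p. \<alpha> (fst p) * ceiling_source C p)"
  using integrable_g integrable_freq_ray(1)[OF integrable_planck[OF constants assms]]
    integrable_\<alpha>_g integrable_freq_ray(1)[OF integrable_\<alpha>_B[OF assms]]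
  by (simp_all add: ceiling_source_def[abs_def] case_prod_unfold distrib_left)

lemma measurable_source:
  assumes T: "bounded_temp C T" and [measurable]: "P \<in> M \<rightarrow>\<^sub>M ray_measure" "X \<in> M \<rightarrow>\<^sub>M borel"
  shows "(\<lambda>q. source T (P q) (X q)) \<in> borel_measurable M"
proof -
  have [measurable]: "T \<in> borel_measurable borel" using T by (simp add: bounded_temp_def)
  have [measurable]: "(\<lambda>q. fst (P q)) \<in> borel_measurable M"
    using measurable_compose[OF assms(2) measurable_fst_ray] .
  have [measurable]: "(\<lambda>q. g (fst (P q)) (snd (P q))) \<in> borel_measurable M"
    using measurable_compose[OF assms(2) measurable_g] .
  show ?thesis unfolding source_def by measurable
qed

lemma measurable_field:
  assumes T: "bounded_temp C T" and P[measurable]: "P \<in> M \<rightarrow>\<^sub>M ray_measure" and X[measurable]: "X \<in> M \<rightarrow>\<^sub>M borel"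
  shows "(\<lambda>q. field T (P q) (X q)) \<in> borel_measurable M"
proof -
  have A: "(\<lambda>q. \<alpha> (fst (P q))) \<in> borel_measurable M" and N: "(\<lambda>q. snd (P q)) \<in> M \<rightarrow>\<^sub>M borel"
    using measurable_compose[OF P measurable_\<alpha>_fst] measurable_compose[OF P measurable_snd_ray] .
  have "(\<lambda>(q, z). source T (P q) z) \<in> borel_measurable (M \<Otimes>\<^sub>M borel)"
    unfolding case_prod_beta by (rule measurable_source[OF T]) measurable
  then show ?thesis
    unfolding field_def
    by (rule measurable_attenuate[OF A N X])
qed

context
  fixes C :: real and T :: "real ^ 3 \<Rightarrow> real"
  assumes T: "bounded_temp C T"
begin

lemma C_nonneg: "0 \<le> C"
  using T by (auto simp: bounded_temp_def intro: order_trans)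

lemma borel_measurable_source: "p \<in> space ray_measure \<Longrightarrow> source T p \<in> borel_measurable borel"
  by (rule measurable_source[OF T, of "\<lambda>_. p" borel "\<lambda>z. z"]) auto

lemma source_bounds:
  assumes "p \<in> space ray_measure"
  shows "0 \<le> source T p z" "source T p z \<le> ceiling_source C p" "\<bar>source T p z\<bar> \<le> ceiling_source C p"
proof -
  have \<nu>: "fst p > 0" and g: "0 \<le> g (fst p) (snd p)"
    using assms g_nonneg by (auto simp: space_ray)
  have Tz: "0 \<le> T z" "T z \<le> C" using T by (auto simp: bounded_temp_def)
  show *: "0 \<le> source T p z"
    using planck_nonneg[OF constants \<nu> Tz(1)] g by (simp add: source_def)
  show "source T p z \<le> ceiling_source C p"
    using planck_mono[OF constants \<nu> Tz] planck_nonneg[OF constants \<nu> C_nonneg] g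
    by (auto simp: source_def ceiling_source_def)
  then show "\<bar>source T p z\<bar> \<le> ceiling_source C p" using * by simp
qed

lemma field_bounds:
  assumes p: "p \<in> space ray_measure"
  shows "0 \<le> field T p x" "field T p x \<le> ceiling_source C p"
proof -
  have a: "0 < \<alpha> (fst p)" using p \<alpha>_pos by (simp add: space_ray)
  show "0 \<le> field T p x"
    unfolding field_def using source_bounds(1)[OF p] by (intro attenuate_nonneg a)
  show "field T p x \<le> ceiling_source C p"
    unfolding field_def using attenuate_le[OF a borel_measurable_source[OF p] source_bounds(3)[OF p], of "snd p" x] by simp
qed

lemma integrable_field:
  "integrable ray_measure (\<lambda>p. field T p x)" "integrable ray_measure (\<lambda>p. \<alpha> (fst p) * field T p x)"
proof -
  have [measurable]: "(\<lambda>p. field T p x) \<in> borel_measurable ray_measure"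
    by (rule measurable_field[OF T]) auto
  show "integrable ray_measure (\<lambda>p. field T p x)"
    by (rule Bochner_Integration.integrable_bound[OF integrable_ceiling_source(1)[OF C_nonneg]])
       (use field_bounds in \<open>auto intro!: AE_I2 order_trans[OF _ abs_ge_self]\<close>)
  show "integrable ray_measure (\<lambda>p. \<alpha> (fst p) * field T p x)"
    by (rule Bochner_Integration.integrable_bound[OF integrable_ceiling_source(2)[OF C_nonneg]])
       (use field_bounds \<alpha>_pos in \<open>auto intro!: AE_I2 order_trans[OF _ abs_ge_self] mult_left_mono simp: abs_mult space_ray less_imp_le\<close>)
qed

lemma integrable_source: "integrable ray_measure (\<lambda>p. \<alpha> (fst p) * source T p x)"
proof -
  have [measurable]: "(\<lambda>p. source T p x) \<in> borel_measurable ray_measure"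
    by (rule measurable_source[OF T]) auto
  show ?thesis
    by (rule Bochner_Integration.integrable_bound[OF integrable_ceiling_source(2)[OF C_nonneg]])
       (use source_bounds \<alpha>_pos in \<open>auto intro!: AE_I2 order_trans[OF _ abs_ge_self] mult_left_mono simp: abs_mult space_ray less_imp_le\<close>)
qed

lemma exchange_eq:
  assumes "x \<in> \<Omega>"
  shows "exchange T x = (\<integral>p. \<alpha> (fst p) * field T p x \<partial>ray_measure)
    - measure sphere_surface (space sphere_surface) * emission h c k \<alpha> (T x)"
proof -
  have "0 \<le> T x" using T by (simp add: bounded_temp_def)
  then show ?thesis
    using integrable_field(2) integrable_source[of x] emission_eq[of "T x"] assms
    by (simp add: exchange_def right_diff_distrib source_def)
qed

lemma exchange_bound: "\<bar>exchange T x\<bar> \<le> (\<integral>p. \<alpha> (fst p) * ceiling_source C p \<partial>ray_measure)"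
proof -
  have "\<bar>exchange T x\<bar> \<le> (\<integral>p. \<bar>\<alpha> (fst p) * (field T p x - source T p x)\<bar> \<partial>ray_measure)"
    unfolding exchange_def by (rule integral_abs_bound)
  also have "\<dots> \<le> (\<integral>p. \<alpha> (fst p) * ceiling_source C p \<partial>ray_measure)"
  proof (rule integral_mono)
    show "integrable ray_measure (\<lambda>p. \<bar>\<alpha> (fst p) * (field T p x - source T p x)\<bar>)"
      using integrable_field(2) integrable_source[of x] by (simp add: right_diff_distrib)
    show "integrable ray_measure (\<lambda>p. \<alpha> (fst p) * ceiling_source C p)"
      by (rule integrable_ceiling_source(2)[OF C_nonneg])
    fix p assume p: "p \<in> space ray_measure"
    have "\<bar>field T p x - source T p x\<bar> \<le> ceiling_source C p"
      using field_bounds[OF p, of x] source_bounds[OF p, of x] by linarith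
    then show "\<bar>\<alpha> (fst p) * (field T p x - source T p x)\<bar> \<le> \<alpha> (fst p) * ceiling_source C p"
      using p \<alpha>_pos by (simp add: abs_mult space_ray less_imp_le mult_left_mono)
  qed
  finally show ?thesis .
qed

lemma measurable_exchange: "exchange T \<in> borel_measurable borel"
proof -
  have "(\<lambda>(x, p). \<alpha> (fst p) * (field T p x - source T p x)) \<in> borel_measurable (borel \<Otimes>\<^sub>M ray_measure)"
    unfolding case_prod_beta
    by (intro borel_measurable_times borel_measurable_diff measurable_field[OF T] measurable_source[OF T]
        measurable_compose[OF measurable_snd measurable_\<alpha>_fst]) measurable
  then show ?thesis
    unfolding exchange_def[abs_def] by (rule ray.borel_measurable_lebesgue_integral)
qed

text \<open>
  Splitting the source into its part inside and its part outside the domain recovers the two terms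
  of the ray formula.
\<close>

lemma intensity_eq_field:
  assumes x: "x \<in> \<Omega>" and p: "p \<in> space ray_measure"
  shows "intensity \<Omega> h c k \<alpha> g T (fst p) x (snd p) = field T p x"
proof -
  have \<nu>: "fst p > 0" and n: "norm (snd p) = 1" using p by (auto simp: space_ray)
  have a: "0 < \<alpha> (fst p)" by (rule \<alpha>_pos[OF \<nu>])
  obtain s where s: "s > 0" "back_dist \<Omega> x (snd p) = s"
    and mem: "\<And>r. 0 \<le> r \<Longrightarrow> x - r *\<^sub>R snd p \<in> \<Omega> \<longleftrightarrow> r < s"
    using backward_ray[OF domain x n] by blast
  have [measurable]: "T \<in> borel_measurable borel" using T by (simp add: bounded_temp_def)
  have B_bounds: "0 \<le> B (fst p) (T z)" "B (fst p) (T z) \<le> B (fst p) C" "0 \<le> B (fst p) C" for z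
    using T planck_nonneg[OF constants \<nu>] planck_mono[OF constants \<nu>] C_nonneg by (auto simp: bounded_temp_def)
  let ?b1 = "\<lambda>z. indicator \<Omega> z * B (fst p) (T z)"
  let ?b2 = "\<lambda>z. indicator (- \<Omega>) z * g (fst p) (snd p)"
  have "field T p x = attenuate (\<alpha> (fst p)) (snd p) (\<lambda>z. ?b1 z + ?b2 z) x"
    unfolding field_def by (intro arg_cong[where f="\<lambda>b. attenuate _ _ b x"]) (auto simp: source_def indicator_def)
  also have "\<dots> = attenuate (\<alpha> (fst p)) (snd p) ?b1 x + attenuate (\<alpha> (fst p)) (snd p) ?b2 x"
    by (rule attenuate_add[OF a, where ?M1.0="B (fst p) C" and ?M2.0="\<bar>g (fst p) (snd p)\<bar>"])
       (use B_bounds in \<open>auto simp: indicator_def\<close>)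
  also have "attenuate (\<alpha> (fst p)) (snd p) ?b2 x = (LINT r|lborel. g (fst p) (snd p) * (exponential_density (\<alpha> (fst p)) r * indicator {s..} r))"
    unfolding attenuate_def using mem
    by (intro Bochner_Integration.integral_cong) (auto simp: indicator_def exponential_density_def not_less)
  also have "\<dots> = g (fst p) (snd p) * exp (- \<alpha> (fst p) * s)"
    using integral_exponential_density_tail[OF a, of s] s(1) by simp
  finally show ?thesis
    using T by (subst intensity_eq[OF domain x n, where \<alpha>=\<alpha> and \<nu>="fst p" and T=T, OF a]) (auto simp: s bounded_temp_def intro: measurable_restrict_space1)
qed

lemma integrable_intensity:
  assumes x: "x \<in> \<Omega>"
  shows "integrable ray_measure (\<lambda>(\<nu>, n). intensity \<Omega> h c k \<alpha> g T \<nu> x n)"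
  using integrable_field(1)[of x] intensity_eq_field[OF x]
  by (simp add: case_prod_unfold cong: Bochner_Integration.integrable_cong)

lemma integrable_field_vec: "integrable ray_measure (\<lambda>p. field T p x *\<^sub>R snd p)"
proof (rule Bochner_Integration.integrable_bound[OF integrable_field(1)[of x]])
  show "AE p in ray_measure. norm (field T p x *\<^sub>R snd p) \<le> norm (field T p x)"
    by (intro AE_I2) (auto simp: space_ray)
qed (use integrable_field(1)[of x] in measurable)

lemma flux_eq:
  assumes x: "x \<in> \<Omega>"
  shows "flux \<Omega> h c k \<alpha> g T x = (\<integral>p. field T p x *\<^sub>R snd p \<partial>ray_measure)"
proof -
  have "flux \<Omega> h c k \<alpha> g T x = (\<integral>\<nu>. (\<integral>n. field T (\<nu>, n) x *\<^sub>R n \<partial>sphere_surface) \<partial>freq)"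
    unfolding flux_def
    by (intro Bochner_Integration.integral_cong) (auto simp: intensity_eq_field[OF x, of "(_, _)", simplified] space_restrict_space space_ray)
  then show ?thesis
    using ray.integral_fst'[OF integrable_field_vec] by simp
qed

end

end

section \<open>The weak conservation law\<close>

context medium
begin

lemma integrable_indicator_domain: "integrable lborel (indicator \<Omega> :: real ^ 3 \<Rightarrow> real)"
  by (rule integrable_real_indicator) (use emeasure_bounded_finite[OF domain(2)] in auto)

context
  fixes C :: real and T :: "real ^ 3 \<Rightarrow> real"
  assumes T: "bounded_temp C T"
begin

lemma measurable_field_pair: "(\<lambda>q. field T (fst q) (snd q)) \<in> borel_measurable (ray_measure \<Otimes>\<^sub>M lborel)"
  by (rule measurable_field[OF T]) auto

lemma measurable_source_pair: "(\<lambda>q. source T (fst q) (snd q)) \<in> borel_measurable (ray_measure \<Otimes>\<^sub>M lborel)"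
  by (rule measurable_source[OF T]) auto

text \<open>
  The distributional divergence of the flux is the rate of energy exchange, up to sign.  For one
  ray, the adjoint of the attenuated average moves the directional derivative of the test function
  onto the reversed average, where it is integrated by parts; then the result is summed over all rays.
\<close>

lemma weak_conservation_law:
  assumes \<phi>: "test_function \<Omega> \<phi>" and G: "\<And>x. GDERIV \<phi> x :> G x"
  shows "(LINT x:\<Omega>|lborel. flux \<Omega> h c k \<alpha> g T x \<bullet> G x) = (LINT x|lborel. \<phi> x * exchange T x)"
proof -
  note cont = test_function_gradient(1,2)[OF \<phi> G]
  obtain K where K: "compact K" "K \<subseteq> \<Omega>" "\<And>x. x \<notin> K \<Longrightarrow> \<phi> x = 0" "\<And>x. x \<notin> K \<Longrightarrow> G x = 0"
    using test_function_gradient(3)[OF \<phi> G] by blast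
  have int_\<phi>: "integrable lborel \<phi>" and int_G: "integrable lborel G"
    using integrable_continuous_compact_support[OF cont(1) K(1,3)]
      integrable_continuous_compact_support[OF cont(2) K(1,4)] by auto
  obtain R where R: "\<And>x. x \<in> K \<Longrightarrow> norm x \<le> R"
    using compact_imp_bounded[OF K(1)] by (auto simp: bounded_iff)
  \<comment> \<open>Strictly outside the ball of radius \<open>R\<close> containing the support.\<close>
  have far: "\<phi> x = 0 \<and> G x = 0" if "norm x \<ge> R + 1" for x
    using K(3,4)[of x] R[of x] that by (cases "x \<in> K") auto
  have [measurable]: "\<phi> \<in> borel_measurable borel" "G \<in> borel_measurable borel"
    using cont by (auto intro: borel_measurable_continuous_onI)
  note [measurable] = measurable_field_pair measurable_source_pair measurable_compose[OF measurable_fst measurable_snd_ray]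
    measurable_compose[OF measurable_fst measurable_\<alpha>_fst]
  let ?F = "\<lambda>p x. field T p x * (snd p \<bullet> G x)"
  let ?E = "\<lambda>p x. \<phi> x * (\<alpha> (fst p) * (field T p x - source T p x))"
  have int_F: "integrable (ray_measure \<Otimes>\<^sub>M lborel) (\<lambda>(p, x). ?F p x)"
  proof (rule Bochner_Integration.integrable_bound)
    show "integrable (ray_measure \<Otimes>\<^sub>M lborel) (\<lambda>(p, x). ceiling_source C p * norm (G x))"
      using integrable_ceiling_source(1)[OF C_nonneg[OF T]] int_G
      by (intro integrable_mult_prod sigma_finite_ray lborel.sigma_finite_measure_axioms) auto
    show "(\<lambda>(p, x). ?F p x) \<in> borel_measurable (ray_measure \<Otimes>\<^sub>M lborel)"
      unfolding case_prod_unfold by measurable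
    show "AE q in ray_measure \<Otimes>\<^sub>M lborel. norm (case q of (p, x) \<Rightarrow> ?F p x)
        \<le> norm (case q of (p, x) \<Rightarrow> ceiling_source C p * norm (G x))"
    proof (rule AE_I2)
      fix q :: "(real \<times> (real ^ 3)) \<times> (real ^ 3)" assume "q \<in> space (ray_measure \<Otimes>\<^sub>M lborel)"
      then have p: "fst q \<in> space ray_measure" by (auto simp: space_pair_measure)
      have "\<bar>snd (fst q) \<bullet> G (snd q)\<bar> \<le> norm (G (snd q))"
        using Cauchy_Schwarz_ineq2[of "snd (fst q)" "G (snd q)"] p by (simp add: space_ray)
      then have "\<bar>field T (fst q) (snd q)\<bar> * \<bar>snd (fst q) \<bullet> G (snd q)\<bar> \<le> \<bar>ceiling_source C (fst q)\<bar> * norm (G (snd q))"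
        using field_bounds[OF T p, of "snd q"] by (intro mult_mono) auto
      then show "norm (case q of (p, x) \<Rightarrow> ?F p x) \<le> norm (case q of (p, x) \<Rightarrow> ceiling_source C p * norm (G x))"
        by (simp add: case_prod_unfold abs_mult)
    qed
  qed
  have int_E: "integrable (ray_measure \<Otimes>\<^sub>M lborel) (\<lambda>(p, x). ?E p x)"
  proof (rule Bochner_Integration.integrable_bound)
    show "integrable (ray_measure \<Otimes>\<^sub>M lborel) (\<lambda>(p, x). (\<alpha> (fst p) * ceiling_source C p) * \<phi> x)"
      using integrable_ceiling_source(2)[OF C_nonneg[OF T]] int_\<phi>
      by (intro integrable_mult_prod sigma_finite_ray lborel.sigma_finite_measure_axioms) auto
    show "(\<lambda>(p, x). ?E p x) \<in> borel_measurable (ray_measure \<Otimes>\<^sub>M lborel)"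
      unfolding case_prod_unfold by measurable
    show "AE q in ray_measure \<Otimes>\<^sub>M lborel. norm (case q of (p, x) \<Rightarrow> ?E p x)
        \<le> norm (case q of (p, x) \<Rightarrow> (\<alpha> (fst p) * ceiling_source C p) * \<phi> x)"
    proof (rule AE_I2)
      fix q :: "(real \<times> (real ^ 3)) \<times> (real ^ 3)" assume "q \<in> space (ray_measure \<Otimes>\<^sub>M lborel)"
      then have p: "fst q \<in> space ray_measure" by (auto simp: space_pair_measure)
      have "\<bar>field T (fst q) (snd q) - source T (fst q) (snd q)\<bar> \<le> \<bar>ceiling_source C (fst q)\<bar>"
        using field_bounds[OF T p, of "snd q"] source_bounds[OF T p, of "snd q"] by linarith
      then have "\<bar>\<phi> (snd q)\<bar> * (\<bar>\<alpha> (fst (fst q))\<bar> * \<bar>field T (fst q) (snd q) - source T (fst q) (snd q)\<bar>)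
          \<le> \<bar>\<phi> (snd q)\<bar> * (\<bar>\<alpha> (fst (fst q))\<bar> * \<bar>ceiling_source C (fst q)\<bar>)"
        by (intro mult_left_mono) auto
      then show "norm (case q of (p, x) \<Rightarrow> ?E p x) \<le> norm (case q of (p, x) \<Rightarrow> (\<alpha> (fst p) * ceiling_source C p) * \<phi> x)"
        by (simp add: case_prod_unfold abs_mult mult_ac)
    qed
  qed
  have along_ray: "(LINT x|lborel. ?F p x) = (LINT x|lborel. ?E p x)" if p: "p \<in> space ray_measure" for p
  proof -
    let ?a = "\<alpha> (fst p)" and ?n = "snd p" and ?b = "source T p"
    have a: "0 < ?a" and n: "norm ?n = 1" using p \<alpha>_pos by (auto simp: space_ray)
    have int_nG: "integrable lborel (\<lambda>x. ?n \<bullet> G x)"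
      using int_G by (rule integrable_inner_right)
    have deriv: "((\<lambda>r. \<phi> (x + r *\<^sub>R ?n)) has_real_derivative ?n \<bullet> G (x + r *\<^sub>R ?n)) (at r)" for x r
    proof -
      have "((\<lambda>r. x + r *\<^sub>R ?n) has_derivative (\<lambda>t. t *\<^sub>R ?n)) (at r)"
        by (auto intro!: derivative_eq_intros)
      from has_derivative_compose[OF this G[of "x + r *\<^sub>R ?n", unfolded gderiv_def]]
      show ?thesis
        by (simp add: has_field_derivative_def mult_commute_abs)
    qed
    note adjoint = attenuate_adjoint[OF a borel_measurable_source[OF T p] source_bounds(3)[OF T p]]
    have b_\<phi>: "integrable lborel (\<lambda>x. ?b x * \<phi> x)"
    proof (rule Bochner_Integration.integrable_bound)
      show "integrable lborel (\<lambda>x. ceiling_source C p * \<phi> x)" using int_\<phi> by simp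
      show "(\<lambda>x. ?b x * \<phi> x) \<in> borel_measurable lborel"
        using borel_measurable_source[OF T p] by measurable
      show "AE x in lborel. norm (?b x * \<phi> x) \<le> norm (ceiling_source C p * \<phi> x)"
        using source_bounds[OF T p] order_trans[OF source_bounds(3)[OF T p] abs_ge_self]
        by (intro AE_I2) (auto simp: abs_mult intro!: mult_right_mono)
    qed
    have "(LINT x|lborel. ?F p x) = (LINT y|lborel. ?b y * attenuate ?a (- ?n) (\<lambda>x. ?n \<bullet> G x) y)"
      unfolding field_def by (rule adjoint(1)[OF int_nG])
    also have "\<dots> = (LINT y|lborel. ?a * (?b y * attenuate ?a (- ?n) \<phi> y - ?b y * \<phi> y))"
    proof (rule Bochner_Integration.integral_cong[OF refl])
      fix y
      have "attenuate ?a (- ?n) (\<lambda>x. ?n \<bullet> G x) y = ?a * (attenuate ?a (- ?n) \<phi> y - \<phi> y)"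
        by (rule attenuate_by_parts[OF a n deriv _ cont(1), where B="R + 1"])
           (use far in \<open>auto intro!: continuous_intros cont(2)\<close>)
      then show "?b y * attenuate ?a (- ?n) (\<lambda>x. ?n \<bullet> G x) y = ?a * (?b y * attenuate ?a (- ?n) \<phi> y - ?b y * \<phi> y)"
        by (simp only:) (simp add: algebra_simps)
    qed
    also have "\<dots> = ?a * ((LINT y|lborel. ?b y * attenuate ?a (- ?n) \<phi> y) - (LINT y|lborel. ?b y * \<phi> y))"
      using adjoint(3)[OF int_\<phi>] b_\<phi> by simp
    also have "\<dots> = ?a * ((LINT x|lborel. field T p x * \<phi> x) - (LINT y|lborel. ?b y * \<phi> y))"
      unfolding field_def adjoint(1)[OF int_\<phi>] ..
    also have "\<dots> = (LINT x|lborel. ?a * (field T p x * \<phi> x - ?b x * \<phi> x))"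
      using adjoint(2)[OF int_\<phi>] b_\<phi> by (simp add: field_def)
    also have "\<dots> = (LINT x|lborel. ?E p x)"
      by (intro Bochner_Integration.integral_cong[OF refl]) (simp add: algebra_simps)
    finally show ?thesis .
  qed
  have "(LINT x:\<Omega>|lborel. flux \<Omega> h c k \<alpha> g T x \<bullet> G x) = (LINT x|lborel. (\<integral>p. ?F p x \<partial>ray_measure))"
    unfolding set_lebesgue_integral_def
  proof (rule Bochner_Integration.integral_cong[OF refl])
    fix x
    show "indicator \<Omega> x *\<^sub>R (flux \<Omega> h c k \<alpha> g T x \<bullet> G x) = (\<integral>p. ?F p x \<partial>ray_measure)"
    proof (cases "x \<in> \<Omega>")
      case True
      then show ?thesis
        using integral_inner_left[of "G x" ray_measure "\<lambda>p. field T p x *\<^sub>R snd p"] integrable_field_vec[OF T, of x]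
        by (simp add: flux_eq[OF T])
    next
      case False
      then have "G x = 0" using K by blast
      then show ?thesis by simp
    qed
  qed
  also have "\<dots> = (\<integral>p. (LINT x|lborel. ?F p x) \<partial>ray_measure)"
    by (rule ray_pos.Fubini_integral[OF int_F])
  also have "\<dots> = (\<integral>p. (LINT x|lborel. ?E p x) \<partial>ray_measure)"
    by (rule Bochner_Integration.integral_cong[OF refl along_ray])
  also have "\<dots> = (LINT x|lborel. (\<integral>p. ?E p x \<partial>ray_measure))"
    by (rule ray_pos.Fubini_integral[OF int_E, symmetric])
  also have "\<dots> = (LINT x|lborel. \<phi> x * exchange T x)"
    by (simp add: exchange_def)
  finally show ?thesis .
qed

lemma flux_measurable: "(\<lambda>x. \<integral>p. field T p x *\<^sub>R snd p \<partial>ray_measure) \<in> borel_measurable borel"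
proof -
  have "(\<lambda>(x, p). field T p x *\<^sub>R snd p) \<in> borel_measurable (borel \<Otimes>\<^sub>M ray_measure)"
    unfolding case_prod_unfold
    by (intro borel_measurable_scaleR measurable_field[OF T] measurable_compose[OF measurable_snd measurable_snd_ray]) measurable
  then show ?thesis
    by (rule ray.borel_measurable_lebesgue_integral)
qed

lemma set_integrable_flux:
  assumes K: "compact K" "K \<subseteq> \<Omega>"
  shows "set_integrable lborel K (flux \<Omega> h c k \<alpha> g T)"
proof -
  let ?F = "\<lambda>x. \<integral>p. field T p x *\<^sub>R snd p \<partial>ray_measure"
  have [measurable]: "K \<in> sets borel" using compact_imp_closed[OF K(1)] by simp
  have bound: "norm (?F x) \<le> (\<integral>p. ceiling_source C p \<partial>ray_measure)" for x
  proof -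
    have "norm (?F x) \<le> (\<integral>p. norm (field T p x *\<^sub>R snd p) \<partial>ray_measure)"
      by (rule integral_norm_bound)
    also have "\<dots> \<le> (\<integral>p. ceiling_source C p \<partial>ray_measure)"
    proof (rule integral_mono)
      show "integrable ray_measure (\<lambda>p. norm (field T p x *\<^sub>R snd p))"
        by (rule integrable_norm[OF integrable_field_vec[OF T]])
      show "norm (field T p x *\<^sub>R snd p) \<le> ceiling_source C p" if "p \<in> space ray_measure" for p
        using field_bounds[OF T that, of x] that by (simp add: space_ray)
    qed (rule integrable_ceiling_source(1)[OF C_nonneg[OF T]])
    finally show ?thesis .
  qed
  have "integrable lborel (\<lambda>x. indicator K x *\<^sub>R ?F x)"
  proof (rule Bochner_Integration.integrable_bound)
    have "integrable lborel (indicator K :: real ^ 3 \<Rightarrow> real)"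
      by (rule integrable_real_indicator) (use emeasure_compact_finite[OF K(1)] in auto)
    then show "integrable lborel (\<lambda>x. indicator K x * (\<integral>p. ceiling_source C p \<partial>ray_measure))" by simp
    show "AE x in lborel. norm (indicator K x *\<^sub>R ?F x) \<le> norm (indicator K x * (\<integral>p. ceiling_source C p \<partial>ray_measure))"
      using bound order_trans[OF bound abs_ge_self] by (intro AE_I2) (auto simp: indicator_def)
  qed (use flux_measurable in measurable)
  moreover have "indicator K x *\<^sub>R flux \<Omega> h c k \<alpha> g T x = indicator K x *\<^sub>R ?F x" for x
    using flux_eq[OF T, of x] K(2) by (auto simp: indicator_def)
  ultimately show ?thesis unfolding set_integrable_def by (simp only:)
qed

lemma radiative_solution_of_exchange_zero:
  assumes "\<And>x. x \<in> \<Omega> \<Longrightarrow> exchange T x = 0"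
  shows "radiative_solution \<Omega> h c k \<alpha> g T"
  unfolding radiative_solution_def divergence_free_on_def
proof (intro conjI allI impI ballI)
  show "T \<in> borel_measurable (restrict_space borel \<Omega>)"
    using T by (auto simp: bounded_temp_def intro: measurable_restrict_space1)
  show "0 \<le> T x" for x using T by (simp add: bounded_temp_def)
  show "AE x\<in>\<Omega> in lborel. integrable ray_measure (\<lambda>(\<nu>, n). intensity \<Omega> h c k \<alpha> g T \<nu> x n)"
    using integrable_intensity[OF T] by (intro AE_I2) auto
  show "set_integrable lborel K (flux \<Omega> h c k \<alpha> g T)" if "compact K \<and> K \<subseteq> \<Omega>" for K
    using that by (intro set_integrable_flux) auto
  fix \<phi> G assume *: "test_function \<Omega> \<phi> \<and> (\<forall>x. GDERIV \<phi> x :> G x)"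
  have "\<phi> x * exchange T x = 0" for x
    using assms[of x] * by (cases "x \<in> \<Omega>") (auto simp: test_function_def)
  then have "(LINT x|lborel. \<phi> x * exchange T x) = 0" by (simp only: Bochner_Integration.integral_zero)
  then show "(LINT x:\<Omega>|lborel. flux \<Omega> h c k \<alpha> g T x \<bullet> G x) = 0"
    using weak_conservation_law[of \<phi> G] * by simp
qed

end

end

section \<open>Uniqueness\<close>

lemma integral_freq_pos:
  fixes f :: "real \<Rightarrow> real"
  assumes f: "integrable freq f" and pos: "\<And>\<nu>. \<nu> > 0 \<Longrightarrow> f \<nu> > 0"
  shows "0 < (\<integral>\<nu>. f \<nu> \<partial>freq)"
proof -
  have ae_nonneg: "AE \<nu> in freq. 0 \<le> f \<nu>"
    by (rule AE_I2) (use pos in \<open>auto simp: space_restrict_space less_imp_le\<close>)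
  have "(\<integral>\<nu>. f \<nu> \<partial>freq) \<noteq> 0"
  proof
    assume "(\<integral>\<nu>. f \<nu> \<partial>freq) = 0"
    then have "AE \<nu> in freq. f \<nu> = 0"
      using integral_nonneg_eq_0_iff_AE[OF f ae_nonneg] by simp
    moreover have "AE \<nu> in freq. f \<nu> \<noteq> 0"
      by (rule AE_I2) (use pos in \<open>force simp: space_restrict_space\<close>)
    ultimately have "AE \<nu> in freq. False" by eventually_elim simp
    then have "AE \<nu> in lborel. \<nu> \<notin> {0::real<..}"
      by (subst (asm) AE_restrict_space_iff) auto
    then have "AE \<nu> in lborel. \<nu> \<notin> {0<..<1::real}"
      by eventually_elim auto
    then have "emeasure lborel {0<..<1::real} = 0"
      by (subst (asm) AE_iff_measurable[where N="{0<..<1}"]) auto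
    then show False by simp
  qed
  moreover have "0 \<le> (\<integral>\<nu>. f \<nu> \<partial>freq)"
    using ae_nonneg by (rule integral_nonneg_AE)
  ultimately show ?thesis by simp
qed

context medium
begin

lemma emission_less:
  assumes "0 \<le> S" "S < T"
  shows "emission h c k \<alpha> S < emission h c k \<alpha> T"
proof -
  have int: "integrable freq (\<lambda>\<nu>. \<alpha> \<nu> * B \<nu> S)" "integrable freq (\<lambda>\<nu>. \<alpha> \<nu> * B \<nu> T)"
    using assms by (auto intro!: integrable_\<alpha>_B)
  have "0 < (\<integral>\<nu>. \<alpha> \<nu> * B \<nu> T - \<alpha> \<nu> * B \<nu> S \<partial>freq)"
    using int planck_less[OF constants _ assms] \<alpha>_pos by (intro integral_freq_pos) auto
  then show ?thesis using int by (simp add: emission_def)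
qed

lemma emission_mono: "0 \<le> S \<Longrightarrow> S \<le> T \<Longrightarrow> emission h c k \<alpha> S \<le> emission h c k \<alpha> T"
  using emission_less[of S T] by (cases "S = T") auto

lemma emission_0: "emission h c k \<alpha> 0 = 0"
  by (simp add: emission_def planck_def)

lemma emission_unbounded:
  obtains m :: nat where "m > 0" "M \<le> emission h c k \<alpha> (real m)"
proof -
  have e1: "0 < emission h c k \<alpha> 1" using emission_less[of 0 1] emission_0 by simp
  obtain m where m: "M < real m * emission h c k \<alpha> 1"
    using reals_Archimedean3[OF e1] by blast
  let ?m = "Suc m"
  have "real ?m * emission h c k \<alpha> 1 = (\<integral>\<nu>. real ?m * (\<alpha> \<nu> * B \<nu> 1) \<partial>freq)"
    by (simp add: emission_def del: of_nat_Suc)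
  also have "\<dots> \<le> emission h c k \<alpha> (real ?m)"
    unfolding emission_def
  proof (rule integral_mono)
    show "integrable freq (\<lambda>\<nu>. real ?m * (\<alpha> \<nu> * B \<nu> 1))" "integrable freq (\<lambda>\<nu>. \<alpha> \<nu> * B \<nu> (real ?m))"
      using integrable_\<alpha>_B[of 1] integrable_\<alpha>_B[of "real ?m"] by (auto simp del: of_nat_Suc)
    fix \<nu> :: real assume "\<nu> \<in> space freq"
    then have \<nu>: "\<nu> > 0" by (simp add: space_restrict_space)
    have "\<alpha> \<nu> * (real ?m * B \<nu> 1) \<le> \<alpha> \<nu> * B \<nu> (real ?m)"
      using planck_superlinear[OF constants \<nu>, of ?m] \<alpha>_pos[OF \<nu>] by (intro mult_left_mono) auto
    then show "real ?m * (\<alpha> \<nu> * B \<nu> 1) \<le> \<alpha> \<nu> * B \<nu> (real ?m)" by (simp only: mult_ac)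
  qed
  finally have "M \<le> emission h c k \<alpha> (real ?m)"
    using m e1 by (simp add: algebra_simps)
  then show ?thesis by (intro that[of ?m]) auto
qed

lemma domain_diameter:
  obtains D where "0 \<le> D" "\<And>x y. x \<in> \<Omega> \<Longrightarrow> y \<in> \<Omega> \<Longrightarrow> dist x y \<le> D"
  using diameter_bounded_bound[OF domain(2)] diameter_ge_0[OF domain(2)] that by blast

lemma bounded_temp_mono: "bounded_temp C T \<Longrightarrow> C \<le> C' \<Longrightarrow> bounded_temp C' T"
  by (auto simp: bounded_temp_def intro: order_trans)

text \<open>
  An estimate in \<open>L\<^sup>1\<close>.  Let \<open>\<delta>\<close> be the difference of the two sources in absolute value.  Since the
  Planck emission is increasing at every frequency, the difference of the emitted powers equals the
  sum of \<open>\<alpha> \<delta>\<close> over all rays, and by energy balance it is at most the sum of \<open>\<alpha>\<close> times the attenuated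
  average of \<open>\<delta>\<close>.  Integrated over the domain, averaging loses at least the fraction \<open>exp (- \<alpha> D)\<close> that
  escapes, which is possible only if \<open>\<delta>\<close> vanishes.
\<close>

lemma exchange_zero_unique:
  assumes T1: "bounded_temp C T1" and T2: "bounded_temp C T2"
    and E1: "AE x\<in>\<Omega> in lborel. exchange T1 x = 0"
    and E2: "AE x\<in>\<Omega> in lborel. exchange T2 x = 0"
  shows "AE x\<in>\<Omega> in lborel. emission h c k \<alpha> (T1 x) = emission h c k \<alpha> (T2 x)"
proof -
  let ?\<sigma> = "measure sphere_surface (space sphere_surface)"
  let ?e = "emission h c k \<alpha>"
  define \<delta> where "\<delta> = (\<lambda>p x. \<bar>source T1 p x - source T2 p x\<bar>)"
  let ?W = "ceiling_source C"
  have C0: "0 \<le> C" by (rule C_nonneg[OF T1])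
  have \<delta>_out: "\<delta> p x = 0" if "x \<notin> \<Omega>" for p x
    using that by (simp add: \<delta>_def source_def)
  have \<delta>_bounds: "0 \<le> \<delta> p x" "\<delta> p x \<le> ?W p" "\<bar>\<delta> p x\<bar> \<le> ?W p" if "p \<in> space ray_measure" for p x
    using source_bounds[OF T1 that, of x] source_bounds[OF T2 that, of x] by (auto simp: \<delta>_def)
  have \<delta>_borel: "\<delta> p \<in> borel_measurable borel" if "p \<in> space ray_measure" for p
    unfolding \<delta>_def using borel_measurable_source[OF T1 that] borel_measurable_source[OF T2 that] by measurable
  have \<alpha>0: "0 < \<alpha> (fst p)" if "p \<in> space ray_measure" for p
    using that \<alpha>_pos by (simp add: space_ray)
  have \<delta>_pair [measurable]: "(\<lambda>q. \<delta> (P q) (X q)) \<in> borel_measurable M"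
    if "P \<in> M \<rightarrow>\<^sub>M ray_measure" "X \<in> M \<rightarrow>\<^sub>M borel" for P X and M :: "'q measure"
    unfolding \<delta>_def using measurable_source[OF T1 that] measurable_source[OF T2 that] by measurable
  define Q where "Q = (\<lambda>p x. attenuate (\<alpha> (fst p)) (snd p) (\<delta> p) x)"
  have Q_bounds: "0 \<le> Q p x" "Q p x \<le> ?W p" if p: "p \<in> space ray_measure" for p x
    using attenuate_nonneg[OF \<alpha>0[OF p], of "\<delta> p"] attenuate_le[OF \<alpha>0[OF p] \<delta>_borel[OF p] \<delta>_bounds(3)[OF p], of "snd p" x] \<delta>_bounds(1)[OF p]
    by (auto simp: Q_def)
  have Q_pair: "(\<lambda>q. Q (fst q) (snd q)) \<in> borel_measurable (ray_measure \<Otimes>\<^sub>M lborel)"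
    unfolding Q_def
  proof (rule measurable_attenuate)
    show "(\<lambda>q. \<alpha> (fst (fst q))) \<in> borel_measurable (ray_measure \<Otimes>\<^sub>M lborel)"
      by (rule measurable_compose[OF measurable_fst measurable_\<alpha>_fst])
    show "(\<lambda>q. snd (fst q)) \<in> (ray_measure \<Otimes>\<^sub>M lborel) \<rightarrow>\<^sub>M borel"
      by (rule measurable_compose[OF measurable_fst measurable_snd_ray])
    show "(\<lambda>(q, z). \<delta> (fst q) z) \<in> borel_measurable ((ray_measure \<Otimes>\<^sub>M lborel) \<Otimes>\<^sub>M borel)"
      unfolding case_prod_unfold by (rule \<delta>_pair) measurable
  qed auto
  obtain D where D: "0 \<le> D" "\<And>x y. x \<in> \<Omega> \<Longrightarrow> y \<in> \<Omega> \<Longrightarrow> dist x y \<le> D"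
    by (rule domain_diameter) blast
  define \<Delta> where "\<Delta> = (\<lambda>p. LINT x|lborel. indicator \<Omega> x * \<delta> p x)"
  have int_\<delta>: "integrable lborel (\<lambda>x. indicator \<Omega> x * \<delta> p x)" if p: "p \<in> space ray_measure" for p
  proof (rule Bochner_Integration.integrable_bound)
    show "integrable lborel (\<lambda>x. indicator \<Omega> x * ?W p)" using integrable_indicator_domain by simp
    show "AE x in lborel. norm (indicator \<Omega> x * \<delta> p x) \<le> norm (indicator \<Omega> x * ?W p)"
      using \<delta>_bounds[OF p] order_trans[OF \<delta>_bounds(3)[OF p] abs_ge_self] by (intro AE_I2) (auto simp: indicator_def)
  qed (use \<delta>_borel[OF p] in measurable)
  have \<Delta>_nonneg: "0 \<le> \<Delta> p" if "p \<in> space ray_measure" for p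
    unfolding \<Delta>_def using \<delta>_bounds[OF that] by (intro Bochner_Integration.integral_nonneg) auto
  \<comment> \<open>Stated for general \<open>R\<close> to apply Fubini both to \<open>\<delta>\<close> and to its attenuated average \<open>Q\<close>.\<close>
  have int_pair: "integrable (ray_measure \<Otimes>\<^sub>M lborel) (\<lambda>(p, x). indicator \<Omega> x * (\<alpha> (fst p) * R p x))"
    if R: "\<And>p x. p \<in> space ray_measure \<Longrightarrow> 0 \<le> R p x" "\<And>p x. p \<in> space ray_measure \<Longrightarrow> R p x \<le> ?W p"
      and Rm[measurable]: "(\<lambda>q. R (fst q) (snd q)) \<in> borel_measurable (ray_measure \<Otimes>\<^sub>M lborel)" for R
  proof (rule Bochner_Integration.integrable_bound)
    show "integrable (ray_measure \<Otimes>\<^sub>M lborel) (\<lambda>(p, x). (\<alpha> (fst p) * ?W p) * indicator \<Omega> x)"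
      using integrable_ceiling_source(2)[OF C0] integrable_indicator_domain
      by (intro integrable_mult_prod sigma_finite_ray lborel.sigma_finite_measure_axioms) auto
    note [measurable] = measurable_compose[OF measurable_fst measurable_\<alpha>_fst]
    show "(\<lambda>(p, x). indicator \<Omega> x * (\<alpha> (fst p) * R p x)) \<in> borel_measurable (ray_measure \<Otimes>\<^sub>M lborel)"
      unfolding case_prod_unfold by measurable
    show "AE q in ray_measure \<Otimes>\<^sub>M lborel. norm (case q of (p, x) \<Rightarrow> indicator \<Omega> x * (\<alpha> (fst p) * R p x))
        \<le> norm (case q of (p, x) \<Rightarrow> (\<alpha> (fst p) * ?W p) * indicator \<Omega> x)"
    proof (rule AE_I2)
      fix q :: "(real \<times> (real ^ 3)) \<times> (real ^ 3)" assume "q \<in> space (ray_measure \<Otimes>\<^sub>M lborel)"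
      then have p: "fst q \<in> space ray_measure" by (auto simp: space_pair_measure)
      have "\<alpha> (fst (fst q)) * R (fst q) (snd q) \<le> \<alpha> (fst (fst q)) * ?W (fst q)"
        using R(2)[OF p] \<alpha>0[OF p] by (intro mult_left_mono) auto
      moreover have "0 \<le> \<alpha> (fst (fst q)) * R (fst q) (snd q)"
        using R(1)[OF p] \<alpha>0[OF p] by simp
      ultimately show "norm (case q of (p, x) \<Rightarrow> indicator \<Omega> x * (\<alpha> (fst p) * R p x))
          \<le> norm (case q of (p, x) \<Rightarrow> (\<alpha> (fst p) * ?W p) * indicator \<Omega> x)"
        by (auto simp: case_prod_unfold indicator_def)
    qed
  qed
  have int1: "integrable (ray_measure \<Otimes>\<^sub>M lborel) (\<lambda>(p, x). indicator \<Omega> x * (\<alpha> (fst p) * \<delta> p x))"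
    by (rule int_pair) (use \<delta>_bounds \<delta>_pair[OF measurable_fst, of snd] in auto)
  have int2: "integrable (ray_measure \<Otimes>\<^sub>M lborel) (\<lambda>(p, x). indicator \<Omega> x * (\<alpha> (fst p) * Q p x))"
    by (rule int_pair) (use Q_bounds Q_pair in auto)
  define A where "A = (\<lambda>x. \<integral>p. indicator \<Omega> x * (\<alpha> (fst p) * \<delta> p x) \<partial>ray_measure)"
  have A_int: "integrable lborel A"
    unfolding A_def using ray_pos.integrable_snd[OF int1] .
  \<comment> \<open>All frequencies contribute with the same sign, so the modulus can be taken outside the integral.\<close>
  have A_eq: "A x = ?\<sigma> * \<bar>?e (T1 x) - ?e (T2 x)\<bar>" if x: "x \<in> \<Omega>" for x
  proof -
    have *: "(\<integral>p. \<alpha> (fst p) * \<bar>B (fst p) S - B (fst p) T\<bar> \<partial>ray_measure) = ?\<sigma> * (?e T - ?e S)"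
      if "0 \<le> S" "S \<le> T" for S T
    proof -
      have "(\<integral>p. \<alpha> (fst p) * \<bar>B (fst p) S - B (fst p) T\<bar> \<partial>ray_measure)
          = (\<integral>p. \<alpha> (fst p) * B (fst p) T - \<alpha> (fst p) * B (fst p) S \<partial>ray_measure)"
        using planck_mono[OF constants _ that]
        by (intro Bochner_Integration.integral_cong) (auto simp: space_ray algebra_simps)
      then show ?thesis
        using that emission_eq[of S] emission_eq[of T] integrable_freq_ray(1)[OF integrable_\<alpha>_B, of S]
          integrable_freq_ray(1)[OF integrable_\<alpha>_B, of T]
        by (simp add: right_diff_distrib)
    qed
    have T0: "0 \<le> T1 x" "0 \<le> T2 x" using T1 T2 by (auto simp: bounded_temp_def)
    have "A x = (\<integral>p. \<alpha> (fst p) * \<bar>B (fst p) (T1 x) - B (fst p) (T2 x)\<bar> \<partial>ray_measure)"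
      using x by (simp add: A_def \<delta>_def source_def)
    then show ?thesis
      using *[of "T1 x" "T2 x"] *[of "T2 x" "T1 x"] T0 emission_mono[of "T1 x" "T2 x"] emission_mono[of "T2 x" "T1 x"]
      by (cases "T1 x \<le> T2 x") (auto simp: abs_minus_commute)
  qed
  have le_ae: "AE x in lborel. A x \<le> (\<integral>p. indicator \<Omega> x * (\<alpha> (fst p) * Q p x) \<partial>ray_measure)"
    using E1 E2
  proof eventually_elim
    case (elim x)
    show ?case
    proof (cases "x \<in> \<Omega>")
      case True
      have "\<bar>?\<sigma> * ?e (T1 x) - ?\<sigma> * ?e (T2 x)\<bar>
          = \<bar>(\<integral>p. \<alpha> (fst p) * field T1 p x \<partial>ray_measure) - (\<integral>p. \<alpha> (fst p) * field T2 p x \<partial>ray_measure)\<bar>"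
        using elim True exchange_eq[OF T1 True] exchange_eq[OF T2 True] by simp
      also have "\<dots> = \<bar>\<integral>p. \<alpha> (fst p) * field T1 p x - \<alpha> (fst p) * field T2 p x \<partial>ray_measure\<bar>"
        using integrable_field(2)[OF T1] integrable_field(2)[OF T2] by simp
      also have "\<dots> \<le> (\<integral>p. \<bar>\<alpha> (fst p) * field T1 p x - \<alpha> (fst p) * field T2 p x\<bar> \<partial>ray_measure)"
        by (rule integral_abs_bound)
      also have "\<dots> \<le> (\<integral>p. \<alpha> (fst p) * Q p x \<partial>ray_measure)"
      proof (rule integral_mono)
        show "integrable ray_measure (\<lambda>p. \<bar>\<alpha> (fst p) * field T1 p x - \<alpha> (fst p) * field T2 p x\<bar>)"
          using integrable_field(2)[OF T1] integrable_field(2)[OF T2] by auto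
        have [measurable]: "(\<lambda>p. Q p x) \<in> borel_measurable ray_measure"
          using measurable_compose[OF _ Q_pair, of "\<lambda>p. (p, x)" ray_measure] by simp
        show "integrable ray_measure (\<lambda>p. \<alpha> (fst p) * Q p x)"
          by (rule Bochner_Integration.integrable_bound[OF integrable_ceiling_source(2)[OF C0]])
             (use Q_bounds \<alpha>0 in \<open>auto intro!: AE_I2 order_trans[OF _ abs_ge_self] mult_left_mono simp: abs_mult less_imp_le\<close>)
        fix p assume p: "p \<in> space ray_measure"
        have "\<bar>field T1 p x - field T2 p x\<bar> \<le> Q p x"
          unfolding field_def Q_def \<delta>_def
          by (rule attenuate_abs_diff[OF \<alpha>0[OF p] borel_measurable_source[OF T1 p] source_bounds(3)[OF T1 p]
                borel_measurable_source[OF T2 p] source_bounds(3)[OF T2 p]])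
        then have "\<alpha> (fst p) * \<bar>field T1 p x - field T2 p x\<bar> \<le> \<alpha> (fst p) * Q p x"
          using \<alpha>0[OF p] by (intro mult_left_mono) auto
        then show "\<bar>\<alpha> (fst p) * field T1 p x - \<alpha> (fst p) * field T2 p x\<bar> \<le> \<alpha> (fst p) * Q p x"
          using \<alpha>0[OF p] by (simp add: right_diff_distrib[symmetric] abs_mult)
      qed
      finally have "?\<sigma> * \<bar>?e (T1 x) - ?e (T2 x)\<bar> \<le> (\<integral>p. \<alpha> (fst p) * Q p x \<partial>ray_measure)"
        using sphere_surface_pos by (simp add: right_diff_distrib[symmetric] abs_mult)
      then show ?thesis using True by (simp add: A_eq)
    qed (simp add: A_def)
  qed
  have pull: "(LINT x|lborel. indicator \<Omega> x * (a * f x)) = a * (LINT x|lborel. indicator \<Omega> x * f x)" for a :: real and f :: "real ^ 3 \<Rightarrow> real"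
    by (simp add: mult.left_commute[of _ a])
  have A_total: "(LINT x|lborel. A x) = (\<integral>p. \<alpha> (fst p) * \<Delta> p \<partial>ray_measure)"
    unfolding A_def \<Delta>_def by (subst ray_pos.Fubini_integral[OF int1]) (simp only: pull)
  have int_\<alpha>\<Delta>: "integrable ray_measure (\<lambda>p. \<alpha> (fst p) * \<Delta> p)"
    using ray_pos.integrable_fst[OF int1] by (simp add: \<Delta>_def pull)
  have "(LINT x|lborel. A x) \<le> (LINT x|lborel. \<integral>p. indicator \<Omega> x * (\<alpha> (fst p) * Q p x) \<partial>ray_measure)"
    by (rule integral_mono_AE[OF A_int ray_pos.integrable_snd[OF int2] le_ae])
  also have "\<dots> = (\<integral>p. \<alpha> (fst p) * (LINT x|lborel. Q p x * indicator \<Omega> x) \<partial>ray_measure)"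
    by (subst ray_pos.Fubini_integral[OF int2]) (simp only: pull mult.commute[of "Q _ _"])
  also have "\<dots> \<le> (\<integral>p. (1 - exp (- \<alpha> (fst p) * D)) * (\<alpha> (fst p) * \<Delta> p) \<partial>ray_measure)"
  proof (rule integral_mono)
    show "integrable ray_measure (\<lambda>p. \<alpha> (fst p) * (LINT x|lborel. Q p x * indicator \<Omega> x))"
      using ray_pos.integrable_fst[OF int2] by (simp only: pull mult.commute[of "Q _ _"])
    show "integrable ray_measure (\<lambda>p. (1 - exp (- \<alpha> (fst p) * D)) * (\<alpha> (fst p) * \<Delta> p))"
    proof (rule Bochner_Integration.integrable_bound[OF int_\<alpha>\<Delta>])
      show "AE p in ray_measure. norm ((1 - exp (- \<alpha> (fst p) * D)) * (\<alpha> (fst p) * \<Delta> p)) \<le> norm (\<alpha> (fst p) * \<Delta> p)"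
        using D(1) \<alpha>0
        by (intro AE_I2) (auto simp: abs_mult less_imp_le intro!: mult_left_le_one_le)
    qed (use int_\<alpha>\<Delta> in measurable)
    fix p assume p: "p \<in> space ray_measure"
    have n: "norm (snd p) = 1" using p by (simp add: space_ray)
    note adj = attenuate_adjoint[OF \<alpha>0[OF p] \<delta>_borel[OF p] \<delta>_bounds(3)[OF p] integrable_indicator_domain, of "snd p"]
    have "(LINT x|lborel. Q p x * indicator \<Omega> x) = (LINT y|lborel. \<delta> p y * attenuate (\<alpha> (fst p)) (- snd p) (indicator \<Omega>) y)"
      unfolding Q_def by (rule adj(1))
    also have "\<dots> \<le> (LINT y|lborel. (1 - exp (- \<alpha> (fst p) * D)) * (indicator \<Omega> y * \<delta> p y))"
    proof (rule integral_mono[OF adj(3)])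
      show "integrable lborel (\<lambda>y. (1 - exp (- \<alpha> (fst p) * D)) * (indicator \<Omega> y * \<delta> p y))"
        using int_\<delta>[OF p] by simp
      fix y
      show "\<delta> p y * attenuate (\<alpha> (fst p)) (- snd p) (indicator \<Omega>) y \<le> (1 - exp (- \<alpha> (fst p) * D)) * (indicator \<Omega> y * \<delta> p y)"
      proof (cases "y \<in> \<Omega>")
        case True
        have "attenuate (\<alpha> (fst p)) (- snd p) (indicator \<Omega>) y \<le> 1 - exp (- \<alpha> (fst p) * D)"
          using D n True by (intro attenuate_indicator_le \<alpha>0[OF p]) auto
        then show ?thesis using True \<delta>_bounds(1)[OF p, of y] by (simp add: mult.commute mult_left_mono)
      qed (simp add: \<delta>_out)
    qed
    also have "\<dots> = (1 - exp (- \<alpha> (fst p) * D)) * \<Delta> p"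
      by (simp add: \<Delta>_def)
    finally have "\<alpha> (fst p) * (LINT x|lborel. Q p x * indicator \<Omega> x) \<le> \<alpha> (fst p) * ((1 - exp (- \<alpha> (fst p) * D)) * \<Delta> p)"
      using \<alpha>0[OF p] by (intro mult_left_mono) auto
    then show "\<alpha> (fst p) * (LINT x|lborel. Q p x * indicator \<Omega> x) \<le> (1 - exp (- \<alpha> (fst p) * D)) * (\<alpha> (fst p) * \<Delta> p)"
      by (simp only: mult.left_commute)
  qed
  finally have le: "(\<integral>p. \<alpha> (fst p) * \<Delta> p \<partial>ray_measure) \<le> (\<integral>p. (1 - exp (- \<alpha> (fst p) * D)) * (\<alpha> (fst p) * \<Delta> p) \<partial>ray_measure)"
    unfolding A_total .
  have int_damped: "integrable ray_measure (\<lambda>p. exp (- \<alpha> (fst p) * D) * (\<alpha> (fst p) * \<Delta> p))"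
  proof (rule Bochner_Integration.integrable_bound[OF int_\<alpha>\<Delta>])
    show "AE p in ray_measure. norm (exp (- \<alpha> (fst p) * D) * (\<alpha> (fst p) * \<Delta> p)) \<le> norm (\<alpha> (fst p) * \<Delta> p)"
      using D(1) \<alpha>0 by (intro AE_I2) (auto simp: abs_mult less_imp_le intro!: mult_left_le_one_le)
  qed (use int_\<alpha>\<Delta> in measurable)
  have damped_nonneg: "AE p in ray_measure. 0 \<le> exp (- \<alpha> (fst p) * D) * (\<alpha> (fst p) * \<Delta> p)"
    using \<alpha>0 \<Delta>_nonneg by (intro AE_I2) (auto simp: less_imp_le)
  have "(\<integral>p. exp (- \<alpha> (fst p) * D) * (\<alpha> (fst p) * \<Delta> p) \<partial>ray_measure) \<le> 0"
    using le int_\<alpha>\<Delta> int_damped by (simp add: left_diff_distrib)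
  moreover have "0 \<le> (\<integral>p. exp (- \<alpha> (fst p) * D) * (\<alpha> (fst p) * \<Delta> p) \<partial>ray_measure)"
    using damped_nonneg by (rule integral_nonneg_AE)
  ultimately have "AE p in ray_measure. exp (- \<alpha> (fst p) * D) * (\<alpha> (fst p) * \<Delta> p) = 0"
    using integral_nonneg_eq_0_iff_AE[OF int_damped damped_nonneg] by simp
  then have "AE p in ray_measure. \<alpha> (fst p) * \<Delta> p = 0"
    by eventually_elim simp
  then have "(LINT x|lborel. A x) = 0"
    unfolding A_total by (rule integral_eq_zero_AE)
  moreover have "0 \<le> A x" for x
    using A_eq[of x] sphere_surface_pos by (cases "x \<in> \<Omega>") (auto simp: A_def)
  ultimately have "AE x in lborel. A x = 0"
    using integral_nonneg_eq_0_iff_AE[OF A_int] by simp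
  then show ?thesis
    by eventually_elim (use A_eq sphere_surface_pos in force)
qed

text \<open>
  A change of temperature on a null set \<open>N\<close> is invisible from almost every point: by Tonelli and
  translation invariance, for almost every \<open>x\<close> almost every ray through \<open>x\<close> meets \<open>N\<close> in a set of
  length zero.
\<close>

lemma AE_same_intensity:
  assumes T: "bounded_temp C T" and T0: "T0 \<in> borel_measurable (restrict_space borel \<Omega>)"
    and eq: "AE x\<in>\<Omega> in lborel. T x = T0 x"
  shows "AE x in lborel. x \<in> \<Omega> \<longrightarrow>
    (AE p in ray_measure. intensity \<Omega> h c k \<alpha> g T0 (fst p) x (snd p) = field T p x)"
proof -
  have T_borel [measurable]: "T \<in> borel_measurable borel" using T by (simp add: bounded_temp_def)
  have T0_borel [measurable]: "(\<lambda>z. indicator \<Omega> z * T0 z) \<in> borel_measurable borel"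
    using T0 by (subst (asm) borel_measurable_restrict_space_iff) auto
  define N where "N = {z. indicator \<Omega> z * T z \<noteq> indicator \<Omega> z * T0 z}"
  have N [measurable]: "N \<in> sets borel" unfolding N_def by measurable
  have "AE x in lborel. x \<notin> N"
    using eq by eventually_elim (auto simp: N_def indicator_def)
  then have N0: "emeasure lborel N = 0"
    by (subst (asm) AE_iff_measurable[where N=N]) auto
  let ?H = "\<lambda>p x. \<integral>\<^sup>+r. indicator N (x - r *\<^sub>R snd p) \<partial>lborel"
  have H_meas: "(\<lambda>(p, x). ?H p x) \<in> borel_measurable (ray_measure \<Otimes>\<^sub>M lborel)"
  proof -
    have [measurable]: "(\<lambda>q. snd (fst (fst q))) \<in> ((ray_measure \<Otimes>\<^sub>M lborel) \<Otimes>\<^sub>M lborel) \<rightarrow>\<^sub>M borel"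
      by (rule measurable_compose[OF measurable_fst measurable_compose[OF measurable_fst measurable_snd_ray]])
    have "(\<lambda>(q, r). indicator N (snd q - r *\<^sub>R snd (fst q)) :: ennreal) \<in> borel_measurable ((ray_measure \<Otimes>\<^sub>M lborel) \<Otimes>\<^sub>M lborel)"
      unfolding case_prod_unfold by measurable
    from lborel.borel_measurable_nn_integral[OF this] show ?thesis
      by (simp add: case_prod_unfold)
  qed
  have H0: "(\<integral>\<^sup>+x. ?H p x \<partial>lborel) = 0" for p :: "real \<times> (real ^ 3)"
  proof -
    have shift0: "(\<integral>\<^sup>+x. indicator N (x - r *\<^sub>R snd p) \<partial>lborel) = 0" for r
    proof -
      have "(\<integral>\<^sup>+x. indicator N (x - r *\<^sub>R snd p) \<partial>lborel) = (\<integral>\<^sup>+x. indicator N x \<partial>distr lborel borel ((+) (- (r *\<^sub>R snd p))))"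
        by (subst nn_integral_distr) (auto simp: algebra_simps)
      then show ?thesis by (simp add: lborel_distr_plus N0)
    qed
    have "(\<integral>\<^sup>+x. ?H p x \<partial>lborel) = (\<integral>\<^sup>+r. (\<integral>\<^sup>+x. indicator N (x - r *\<^sub>R snd p) \<partial>lborel) \<partial>lborel)"
      by (rule lborel_pair.Fubini') measurable
    also have "\<dots> = 0" by (simp only: shift0) simp
    finally show ?thesis .
  qed
  have "(\<integral>\<^sup>+x. (\<integral>\<^sup>+p. ?H p x \<partial>ray_measure) \<partial>lborel) = 0"
    using ray_pos.Fubini'[OF H_meas] H0 by simp
  moreover have "(\<lambda>(x, p). ?H p x) \<in> borel_measurable (lborel \<Otimes>\<^sub>M ray_measure)"
    using measurable_compose[OF measurable_pair_swap' H_meas] by (simp add: case_prod_unfold)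
  then have "(\<lambda>x. \<integral>\<^sup>+p. ?H p x \<partial>ray_measure) \<in> borel_measurable lborel"
    by (rule ray.borel_measurable_nn_integral)
  ultimately have "AE x in lborel. (\<integral>\<^sup>+p. ?H p x \<partial>ray_measure) = 0"
    by (subst (asm) nn_integral_0_iff_AE)
  then have "AE x in lborel. AE p in ray_measure. ?H p x = 0"
  proof eventually_elim
    case (elim x)
    have "(\<lambda>p. ?H p x) \<in> borel_measurable ray_measure"
      using measurable_compose[OF _ H_meas, of "\<lambda>p. (p, x)" ray_measure] by simp
    then show ?case using elim by (subst (asm) nn_integral_0_iff_AE) auto
  qed
  then show ?thesis
  proof eventually_elim
    case (elim x)
    show ?case
    proof
      assume x: "x \<in> \<Omega>"
      show "AE p in ray_measure. intensity \<Omega> h c k \<alpha> g T0 (fst p) x (snd p) = field T p x"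
        using elim AE_space
      proof eventually_elim
        case (elim p)
        then have p: "p \<in> space ray_measure" by simp
        have \<nu>: "fst p > 0" and n: "norm (snd p) = 1" using p by (auto simp: space_ray)
        have ae: "AE r in lborel. x - r *\<^sub>R snd p \<notin> N"
          using elim(1) by (subst (asm) nn_integral_0_iff_AE) (auto simp: indicator_def split: if_splits)
        let ?B = "\<lambda>S z. indicator \<Omega> z * B (fst p) (S z)"
        have B_eq: "?B S z = indicator \<Omega> z * B (fst p) (indicator \<Omega> z * S z)" for S z
          by (simp add: indicator_def)
        have "attenuate (\<alpha> (fst p)) (snd p) (?B T0) x = attenuate (\<alpha> (fst p)) (snd p) (?B T) x"
          unfolding attenuate_def
        proof (rule integral_cong_AE)
          have "(\<lambda>z. ?B S z) \<in> borel_measurable borel" if "(\<lambda>z. indicator \<Omega> z * S z) \<in> borel_measurable borel" for S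
            unfolding B_eq using that by measurable
          from this[of T0] this[of T]
          have [measurable]: "?B T0 \<in> borel_measurable borel" "?B T \<in> borel_measurable borel"
            by measurable
          show "(\<lambda>r. exponential_density (\<alpha> (fst p)) r * ?B T0 (x - r *\<^sub>R snd p)) \<in> borel_measurable lborel"
            "(\<lambda>r. exponential_density (\<alpha> (fst p)) r * ?B T (x - r *\<^sub>R snd p)) \<in> borel_measurable lborel"
            by measurable
          show "AE r in lborel. exponential_density (\<alpha> (fst p)) r * ?B T0 (x - r *\<^sub>R snd p)
              = exponential_density (\<alpha> (fst p)) r * ?B T (x - r *\<^sub>R snd p)"
            using ae by eventually_elim (auto simp: N_def indicator_def)
        qed
        then have "intensity \<Omega> h c k \<alpha> g T0 (fst p) x (snd p) = intensity \<Omega> h c k \<alpha> g T (fst p) x (snd p)"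
          using intensity_eq[OF domain x n, where \<alpha>=\<alpha> and \<nu>="fst p" and T=T0, OF \<alpha>_pos[OF \<nu>] T0]
            intensity_eq[OF domain x n, where \<alpha>=\<alpha> and \<nu>="fst p" and T=T, OF \<alpha>_pos[OF \<nu>] measurable_restrict_space1[OF T_borel]]
          by simp
        then show ?case by (simp add: intensity_eq_field[OF T x p])
      qed
    qed
  qed
qed

lemma flux_of_AE_same_intensity:
  assumes T: "bounded_temp C T" and x: "x \<in> \<Omega>"
    and int: "integrable ray_measure (\<lambda>(\<nu>, n). intensity \<Omega> h c k \<alpha> g T0 \<nu> x n)"
    and eq: "AE p in ray_measure. intensity \<Omega> h c k \<alpha> g T0 (fst p) x (snd p) = field T p x"
  shows "flux \<Omega> h c k \<alpha> g T0 x = flux \<Omega> h c k \<alpha> g T x"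
proof -
  let ?I = "\<lambda>p. intensity \<Omega> h c k \<alpha> g T0 (fst p) x (snd p)"
  have int': "integrable ray_measure ?I" using int by (simp add: case_prod_unfold)
  have int_vec: "integrable ray_measure (\<lambda>p. ?I p *\<^sub>R snd p)"
  proof (rule Bochner_Integration.integrable_bound[OF int'])
    show "AE p in ray_measure. norm (?I p *\<^sub>R snd p) \<le> norm (?I p)"
      by (intro AE_I2) (auto simp: space_ray)
    show "(\<lambda>p. ?I p *\<^sub>R snd p) \<in> borel_measurable ray_measure"
      using borel_measurable_integrable[OF int'] by measurable
  qed
  have "flux \<Omega> h c k \<alpha> g T0 x = (\<integral>p. ?I p *\<^sub>R snd p \<partial>ray_measure)"
    unfolding flux_def using ray.integral_fst'[OF int_vec] by simp
  also have "\<dots> = (\<integral>p. field T p x *\<^sub>R snd p \<partial>ray_measure)"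
    using eq borel_measurable_integrable[OF int_vec] borel_measurable_integrable[OF integrable_field_vec[OF T, of x]]
    by (intro integral_cong_AE) (auto elim!: eventually_mono)
  also have "\<dots> = flux \<Omega> h c k \<alpha> g T x" by (rule flux_eq[OF T x, symmetric])
  finally show ?thesis .
qed

text \<open>
  An emission bounded by \<open>M\<close> bounds the temperature by any level whose emission is at least \<open>M\<close>.
\<close>

lemma bounded_representative:
  assumes T0: "T0 \<in> borel_measurable (restrict_space borel \<Omega>)" "\<And>x. x \<in> \<Omega> \<Longrightarrow> 0 \<le> T0 x"
    and L: "Linf_nonneg \<Omega> (\<lambda>x. emission h c k \<alpha> (T0 x))"
  obtains C T where "bounded_temp C T" "AE x\<in>\<Omega> in lborel. T x = T0 x"
proof -
  obtain M where M: "AE x\<in>\<Omega> in lborel. 0 \<le> emission h c k \<alpha> (T0 x) \<and> emission h c k \<alpha> (T0 x) \<le> M"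
    using L by (auto simp: Linf_nonneg_def)
  obtain m where m: "m > 0" "M \<le> emission h c k \<alpha> (real m)"
    by (rule emission_unbounded)
  have T0_borel [measurable]: "(\<lambda>z. indicator \<Omega> z * T0 z) \<in> borel_measurable borel"
    using T0(1) by (subst (asm) borel_measurable_restrict_space_iff) auto
  show ?thesis
  proof (rule that)
    have "(\<lambda>x. min (indicator \<Omega> x * T0 x) (real m)) \<in> borel_measurable borel" by measurable
    then show "bounded_temp (real m) (\<lambda>x. min (indicator \<Omega> x * T0 x) (real m))"
      unfolding bounded_temp_def using T0(2) by (intro conjI allI) (simp_all add: indicator_def)
    show "AE x\<in>\<Omega> in lborel. min (indicator \<Omega> x * T0 x) (real m) = T0 x"
      using M
    proof eventually_elim
      case (elim x)
      show ?case
      proof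
        assume x: "x \<in> \<Omega>"
        have "\<not> real m < T0 x"
          using emission_less[of "real m" "T0 x"] elim x m by force
        then show "min (indicator \<Omega> x * T0 x) (real m) = T0 x" using x by simp
      qed
    qed
  qed
qed

lemma exchange_zero_of_radiative_solution:
  assumes sol: "radiative_solution \<Omega> h c k \<alpha> g T0"
    and T: "bounded_temp C T" and eq: "AE x\<in>\<Omega> in lborel. T x = T0 x"
  shows "AE x\<in>\<Omega> in lborel. exchange T x = 0"
proof -
  let ?Fo = "flux \<Omega> h c k \<alpha> g T0" and ?F = "flux \<Omega> h c k \<alpha> g T"
  have T0: "T0 \<in> borel_measurable (restrict_space borel \<Omega>)"
    and int: "AE x\<in>\<Omega> in lborel. integrable ray_measure (\<lambda>(\<nu>, n). intensity \<Omega> h c k \<alpha> g T0 \<nu> x n)"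
    and loc: "\<And>K. compact K \<Longrightarrow> K \<subseteq> \<Omega> \<Longrightarrow> set_integrable lborel K ?Fo"
    and div0: "\<And>\<phi> G. test_function \<Omega> \<phi> \<Longrightarrow> (\<And>x. GDERIV \<phi> x :> G x) \<Longrightarrow> (LINT x:\<Omega>|lborel. ?Fo x \<bullet> G x) = 0"
    using sol unfolding radiative_solution_def divergence_free_on_def by blast+
  have flux_ae: "AE x\<in>\<Omega> in lborel. ?Fo x = ?F x"
    using AE_same_intensity[OF T T0 eq] int
    by eventually_elim (auto intro: flux_of_AE_same_intensity[OF T])
  have weak: "(LINT x|lborel. \<phi> x * (indicator \<Omega> x * exchange T x)) = 0" if \<phi>: "test_function \<Omega> \<phi>" for \<phi>
  proof -
    have "Ck (Suc 0) \<phi>" using \<phi> by (auto simp only: test_function_def)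
    then obtain G where G: "\<And>x. GDERIV \<phi> x :> G x" by auto
    obtain K where K: "compact K" "K \<subseteq> \<Omega>" "\<And>x. x \<notin> K \<Longrightarrow> \<phi> x = 0" "\<And>x. x \<notin> K \<Longrightarrow> G x = 0"
      using test_function_gradient(3)[OF \<phi> G] by blast
    have [measurable]: "G \<in> borel_measurable borel"
      using test_function_gradient(2)[OF \<phi> G] by (rule borel_measurable_continuous_onI)
    have meas: "(\<lambda>x. indicator \<Omega> x *\<^sub>R (F x \<bullet> G x)) \<in> borel_measurable lborel" if "set_integrable lborel K F" for F
    proof -
      have [measurable]: "(\<lambda>x. indicator K x *\<^sub>R F x) \<in> borel_measurable lborel"
        using that by (auto simp: set_integrable_def)
      have "(\<lambda>x. indicator \<Omega> x *\<^sub>R (F x \<bullet> G x)) = (\<lambda>x. (indicator K x *\<^sub>R F x) \<bullet> G x)"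
        using K by (auto simp: indicator_def fun_eq_iff)
      also have "\<dots> \<in> borel_measurable lborel" by measurable
      finally show ?thesis .
    qed
    have "(LINT x|lborel. \<phi> x * (indicator \<Omega> x * exchange T x)) = (LINT x|lborel. \<phi> x * exchange T x)"
      using K by (intro Bochner_Integration.integral_cong) (auto simp: indicator_def)
    also have "\<dots> = (LINT x:\<Omega>|lborel. ?F x \<bullet> G x)"
      by (rule weak_conservation_law[OF T \<phi> G, symmetric])
    also have "\<dots> = (LINT x:\<Omega>|lborel. ?Fo x \<bullet> G x)"
      unfolding set_lebesgue_integral_def
    proof (rule integral_cong_AE)
      show "AE x in lborel. indicator \<Omega> x *\<^sub>R (?F x \<bullet> G x) = indicator \<Omega> x *\<^sub>R (?Fo x \<bullet> G x)"
        using flux_ae by eventually_elim (auto simp: indicator_def)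
    qed (intro meas loc K set_integrable_flux[OF T])+
    also have "\<dots> = 0" by (rule div0[OF \<phi> G])
    finally show ?thesis .
  qed
  have int_ex: "integrable lborel (\<lambda>x. indicator \<Omega> x * exchange T x)"
  proof (rule Bochner_Integration.integrable_bound)
    show "integrable lborel (\<lambda>x. indicator \<Omega> x * (\<integral>p. \<alpha> (fst p) * ceiling_source C p \<partial>ray_measure))"
      using integrable_indicator_domain by simp
    show "AE x in lborel. norm (indicator \<Omega> x * exchange T x) \<le> norm (indicator \<Omega> x * (\<integral>p. \<alpha> (fst p) * ceiling_source C p \<partial>ray_measure))"
      using exchange_bound[OF T] order_trans[OF exchange_bound[OF T] abs_ge_self]
      by (intro AE_I2) (auto simp: indicator_def)
  qed (use measurable_exchange[OF T] in measurable)
  have "AE x\<in>\<Omega> in lborel. indicator \<Omega> x * exchange T x = 0"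
    using weak by (intro fundamental_lemma domain(1) int_ex)
  then show ?thesis by eventually_elim auto
qed

lemma radiative_solution_unique:
  assumes "radiative_solution \<Omega> h c k \<alpha> g T1" "Linf_nonneg \<Omega> (\<lambda>x. emission h c k \<alpha> (T1 x))"
    and "radiative_solution \<Omega> h c k \<alpha> g T2" "Linf_nonneg \<Omega> (\<lambda>x. emission h c k \<alpha> (T2 x))"
  shows "AE x\<in>\<Omega> in lborel. emission h c k \<alpha> (T1 x) = emission h c k \<alpha> (T2 x)"
proof -
  have rep: "\<exists>C S. bounded_temp C S \<and> (AE x\<in>\<Omega> in lborel. S x = T x)"
    if "radiative_solution \<Omega> h c k \<alpha> g T" "Linf_nonneg \<Omega> (\<lambda>x. emission h c k \<alpha> (T x))" for T
    using bounded_representative[of T] that unfolding radiative_solution_def by metis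
  obtain C1 S1 where S1: "bounded_temp C1 S1" "AE x\<in>\<Omega> in lborel. S1 x = T1 x"
    using rep[OF assms(1,2)] by blast
  obtain C2 S2 where S2: "bounded_temp C2 S2" "AE x\<in>\<Omega> in lborel. S2 x = T2 x"
    using rep[OF assms(3,4)] by blast
  have "AE x\<in>\<Omega> in lborel. emission h c k \<alpha> (S1 x) = emission h c k \<alpha> (S2 x)"
  proof (rule exchange_zero_unique)
    show "bounded_temp (max C1 C2) S1" "bounded_temp (max C1 C2) S2"
      using S1 S2 bounded_temp_mono by (auto intro: bounded_temp_mono)
    show "AE x\<in>\<Omega> in lborel. exchange S1 x = 0"
      by (rule exchange_zero_of_radiative_solution[OF assms(1) S1])
    show "AE x\<in>\<Omega> in lborel. exchange S2 x = 0"
      by (rule exchange_zero_of_radiative_solution[OF assms(3) S2])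
  qed
  then show ?thesis
    using S1(2) S2(2) by eventually_elim auto
qed

end

section \<open>Existence\<close>

context medium
begin

lemma emission_tendsto:
  assumes t: "\<And>m. 0 \<le> t m \<and> t m \<le> C" and lim: "t \<longlonglongrightarrow> s"
  shows "(\<lambda>m. emission h c k \<alpha> (t m)) \<longlonglongrightarrow> emission h c k \<alpha> s"
  unfolding emission_def
proof (rule integral_dominated_convergence[where w="\<lambda>\<nu>. \<alpha> \<nu> * B \<nu> C"])
  have s: "0 \<le> s"
    using LIMSEQ_le_const[OF lim, of 0] t by auto
  have C: "0 \<le> C" using t[of 0] by simp
  show "integrable freq (\<lambda>\<nu>. \<alpha> \<nu> * B \<nu> C)" by (rule integrable_\<alpha>_B[OF C])
  show "(\<lambda>\<nu>. \<alpha> \<nu> * B \<nu> s) \<in> borel_measurable freq" "(\<lambda>\<nu>. \<alpha> \<nu> * B \<nu> (t m)) \<in> borel_measurable freq" for m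
    using integrable_\<alpha>_B[OF s] integrable_\<alpha>_B[of "t m"] t[of m] by auto
  show "AE \<nu> in freq. (\<lambda>m. \<alpha> \<nu> * B \<nu> (t m)) \<longlonglongrightarrow> \<alpha> \<nu> * B \<nu> s"
  proof (rule AE_I2)
    fix \<nu> :: real assume "\<nu> \<in> space freq"
    then have \<nu>: "\<nu> > 0" by (simp add: space_restrict_space)
    show "(\<lambda>m. \<alpha> \<nu> * B \<nu> (t m)) \<longlonglongrightarrow> \<alpha> \<nu> * B \<nu> s"
      using t s by (intro tendsto_mult tendsto_const continuous_on_tendsto_compose[OF continuous_on_planck[OF constants \<nu>] lim]) auto
  qed
  show "AE \<nu> in freq. norm (\<alpha> \<nu> * B \<nu> (t m)) \<le> \<alpha> \<nu> * B \<nu> C" for m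
  proof (rule AE_I2)
    fix \<nu> :: real assume "\<nu> \<in> space freq"
    then have \<nu>: "\<nu> > 0" by (simp add: space_restrict_space)
    show "norm (\<alpha> \<nu> * B \<nu> (t m)) \<le> \<alpha> \<nu> * B \<nu> C"
      using planck_mono[OF constants \<nu>, of "t m" C] planck_nonneg[OF constants \<nu>, of "t m"] t[of m] \<alpha>_pos[OF \<nu>]
      by (simp add: abs_mult)
  qed
qed

lemma continuous_on_emission: "continuous_on {0..C} (emission h c k \<alpha>)"
  by (rule continuous_on_sequentiallyI) (auto intro!: emission_tendsto[where C=C])

text \<open>
  The inverse of the emission on \<open>[0, C]\<close>.  As a supremum, of a set that is nonempty because \<open>u\<close> is
  cut off at 0, it is monotone on the whole line, and monotone functions are Borel.
\<close>

definition temperature :: "real \<Rightarrow> real \<Rightarrow> real" where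
  "temperature C u = Sup {t \<in> {0..C}. emission h c k \<alpha> t \<le> max 0 u}"

context
  fixes C :: real
  assumes C: "0 \<le> C"
begin

lemma temperature_set: "0 \<in> {t \<in> {0..C}. emission h c k \<alpha> t \<le> max 0 u}" "bdd_above {t \<in> {0..C}. emission h c k \<alpha> t \<le> max 0 u}"
  using C emission_0 by (auto intro!: bdd_aboveI[of _ C])

lemma temperature_bounds: "0 \<le> temperature C u" "temperature C u \<le> C"
proof -
  show "0 \<le> temperature C u"
    unfolding temperature_def using temperature_set by (rule cSup_upper)
  show "temperature C u \<le> C"
    unfolding temperature_def using temperature_set(1) by (intro cSup_least) auto
qed

lemma mono_temperature: "mono (temperature C)"
proof (rule monoI)
  fix u v :: real assume "u \<le> v"
  then show "temperature C u \<le> temperature C v"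
    unfolding temperature_def using temperature_set(1)[of u]
    by (intro cSup_subset_mono temperature_set) (auto simp: max_def split: if_splits)
qed

lemma emission_temperature:
  assumes u: "0 \<le> u" "u \<le> emission h c k \<alpha> C"
  shows "emission h c k \<alpha> (temperature C u) = u"
proof -
  obtain t where t: "0 \<le> t" "t \<le> C" "emission h c k \<alpha> t = u"
    using IVT'[of "emission h c k \<alpha>" 0 u C] u C emission_0 continuous_on_emission[of C] by auto
  have "{t \<in> {0..C}. emission h c k \<alpha> t \<le> max 0 u} = {0..t}"
  proof (intro set_eqI iffI)
    fix r assume "r \<in> {t \<in> {0..C}. emission h c k \<alpha> t \<le> max 0 u}"
    then show "r \<in> {0..t}" using t u emission_less[of t r] by (auto simp: not_less[symmetric])
  next
    fix r assume "r \<in> {0..t}"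
    then show "r \<in> {t \<in> {0..C}. emission h c k \<alpha> t \<le> max 0 u}" using t u emission_mono[of r t] by auto
  qed
  then show ?thesis using t by (simp add: temperature_def)
qed

end

definition absorbed :: "(real ^ 3 \<Rightarrow> real) \<Rightarrow> real ^ 3 \<Rightarrow> real" where
  "absorbed T x = (\<integral>p. \<alpha> (fst p) * field T p x \<partial>ray_measure) / measure sphere_surface (space sphere_surface)"

lemma absorbed_nonneg:
  assumes T: "bounded_temp C T"
  shows "0 \<le> absorbed T x"
  unfolding absorbed_def using field_bounds[OF T] \<alpha>_pos
  by (intro divide_nonneg_nonneg Bochner_Integration.integral_nonneg) (auto simp: space_ray less_imp_le)

lemma absorbed_mono:
  assumes T: "bounded_temp C T" and S: "bounded_temp C S" and le: "\<And>x. T x \<le> S x"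
  shows "absorbed T x \<le> absorbed S x"
  unfolding absorbed_def
proof (intro divide_right_mono integral_mono integrable_field(2)[OF T] integrable_field(2)[OF S])
  fix p assume p: "p \<in> space ray_measure"
  then have \<nu>: "fst p > 0" and a: "0 < \<alpha> (fst p)" using \<alpha>_pos by (auto simp: space_ray)
  have "source T p z \<le> source S p z" for z
    using planck_mono[OF constants \<nu> _ le] T by (simp add: source_def bounded_temp_def)
  then show "\<alpha> (fst p) * field T p x \<le> \<alpha> (fst p) * field S p x"
    unfolding field_def using a
    by (intro mult_left_mono attenuate_mono[OF a borel_measurable_source[OF T p] source_bounds(3)[OF T p]
          borel_measurable_source[OF S p] source_bounds(3)[OF S p]]) auto
qed simp

lemma measurable_absorbed:
  assumes T: "bounded_temp C T"
  shows "absorbed T \<in> borel_measurable borel"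
proof -
  have "(\<lambda>(x, p). \<alpha> (fst p) * field T p x) \<in> borel_measurable (borel \<Otimes>\<^sub>M ray_measure)"
    unfolding case_prod_unfold
    by (intro borel_measurable_times measurable_field[OF T] measurable_compose[OF measurable_snd measurable_\<alpha>_fst]) measurable
  then have [measurable]: "(\<lambda>x. \<integral>p. \<alpha> (fst p) * field T p x \<partial>ray_measure) \<in> borel_measurable borel"
    by (rule ray.borel_measurable_lebesgue_integral)
  show ?thesis unfolding absorbed_def by measurable
qed

lemma absorbed_tendsto:
  assumes T: "\<And>m. bounded_temp C (T m)" and S: "bounded_temp C S" and lim: "\<And>x. (\<lambda>m. T m x) \<longlonglongrightarrow> S x"
  shows "(\<lambda>m. absorbed (T m) x) \<longlonglongrightarrow> absorbed S x"
  unfolding absorbed_def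
proof (intro tendsto_divide tendsto_const)
  show "(\<lambda>m. \<integral>p. \<alpha> (fst p) * field (T m) p x \<partial>ray_measure) \<longlonglongrightarrow> (\<integral>p. \<alpha> (fst p) * field S p x \<partial>ray_measure)"
  proof (rule integral_dominated_convergence[where w="\<lambda>p. \<alpha> (fst p) * ceiling_source C p"])
    show "integrable ray_measure (\<lambda>p. \<alpha> (fst p) * ceiling_source C p)"
      by (rule integrable_ceiling_source(2)[OF C_nonneg[OF S]])
    show "(\<lambda>p. \<alpha> (fst p) * field S p x) \<in> borel_measurable ray_measure"
      "(\<lambda>p. \<alpha> (fst p) * field (T m) p x) \<in> borel_measurable ray_measure" for m
      using integrable_field(2)[OF S] integrable_field(2)[OF T] by auto
    show "AE p in ray_measure. norm (\<alpha> (fst p) * field (T m) p x) \<le> \<alpha> (fst p) * ceiling_source C p" for m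
      using field_bounds[OF T] \<alpha>_pos
      by (intro AE_I2) (auto simp: abs_mult space_ray less_imp_le intro!: mult_left_mono)
    show "AE p in ray_measure. (\<lambda>m. \<alpha> (fst p) * field (T m) p x) \<longlonglongrightarrow> \<alpha> (fst p) * field S p x"
    proof (rule AE_I2)
      fix p assume p: "p \<in> space ray_measure"
      then have \<nu>: "fst p > 0" and a: "0 < \<alpha> (fst p)" using \<alpha>_pos by (auto simp: space_ray)
      have source_lim: "(\<lambda>m. source (T m) p z) \<longlonglongrightarrow> source S p z" for z
      proof (cases "z \<in> \<Omega>")
        case True
        have "(\<lambda>m. B (fst p) (T m z)) \<longlonglongrightarrow> B (fst p) (S z)"
          using T S by (intro continuous_on_tendsto_compose[OF continuous_on_planck[OF constants \<nu>] lim]) (auto simp: bounded_temp_def)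
        then show ?thesis using True by (simp add: source_def)
      qed (simp add: source_def)
      have "(\<lambda>m. field (T m) p x) \<longlonglongrightarrow> field S p x"
        unfolding field_def attenuate_def
      proof (rule integral_dominated_convergence[where w="\<lambda>r. exponential_density (\<alpha> (fst p)) r * ceiling_source C p"])
        show "integrable lborel (\<lambda>r. exponential_density (\<alpha> (fst p)) r * ceiling_source C p)"
          using integral_erlang_density(1)[OF a, of 0] by simp
        show "AE r in lborel. (\<lambda>m. exponential_density (\<alpha> (fst p)) r * source (T m) p (x - r *\<^sub>R snd p))
            \<longlonglongrightarrow> exponential_density (\<alpha> (fst p)) r * source S p (x - r *\<^sub>R snd p)"
          by (intro AE_I2 tendsto_mult tendsto_const source_lim)
        show "AE r in lborel. norm (exponential_density (\<alpha> (fst p)) r * source (T m) p (x - r *\<^sub>R snd p))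
            \<le> exponential_density (\<alpha> (fst p)) r * ceiling_source C p" for m
          using source_bounds(3)[OF T p] exponential_density_nonneg[OF a]
          by (intro AE_I2) (auto simp: abs_mult intro!: mult_left_mono)
      qed (use borel_measurable_integrable[OF integrable_attenuate[OF a borel_measurable_source[OF S p] source_bounds(3)[OF S p]]]
            borel_measurable_integrable[OF integrable_attenuate[OF a borel_measurable_source[OF T p] source_bounds(3)[OF T p]]] in auto)
      then show "(\<lambda>m. \<alpha> (fst p) * field (T m) p x) \<longlonglongrightarrow> \<alpha> (fst p) * field S p x"
        by (intro tendsto_mult tendsto_const)
    qed
  qed
qed (use sphere_surface_pos in simp)

text \<open>
  In a medium at constant temperature \<open>C\<close>, the absorbed power misses at least \<open>exp (- \<alpha> D)\<close> of what the
  medium emits, and gains at most the total \<open>\<integral> \<alpha> g\<close> of the boundary radiation.  The loss grows at least linearly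
  in \<open>C\<close> by \<open>planck_superlinear\<close>, so it outweighs the gain for large \<open>C\<close>.
\<close>

lemma constant_supersolution:
  obtains C where "0 \<le> C"
    "\<And>T x. bounded_temp C T \<Longrightarrow> x \<in> \<Omega> \<Longrightarrow> absorbed T x \<le> emission h c k \<alpha> C"
proof -
  let ?\<sigma> = "measure sphere_surface (space sphere_surface)"
  obtain D where D: "0 \<le> D" "\<And>x y. x \<in> \<Omega> \<Longrightarrow> y \<in> \<Omega> \<Longrightarrow> dist x y \<le> D"
    by (rule domain_diameter) blast
  note [measurable] = borel_measurable_integrable[OF integrable_\<alpha>]
  have int_damped: "integrable freq (\<lambda>\<nu>. exp (- \<alpha> \<nu> * D) * (\<alpha> \<nu> * B \<nu> T))" if "0 \<le> T" for T
  proof (rule Bochner_Integration.integrable_bound[OF integrable_\<alpha>_B[OF that]])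
    note [measurable] = borel_measurable_integrable[OF integrable_\<alpha>_B[OF that]]
    show "(\<lambda>\<nu>. exp (- \<alpha> \<nu> * D) * (\<alpha> \<nu> * B \<nu> T)) \<in> borel_measurable freq" by measurable
    show "AE \<nu> in freq. norm (exp (- \<alpha> \<nu> * D) * (\<alpha> \<nu> * B \<nu> T)) \<le> norm (\<alpha> \<nu> * B \<nu> T)"
      using D(1) \<alpha>_pos by (intro AE_I2) (auto simp: abs_mult space_restrict_space less_imp_le intro!: mult_left_le_one_le)
  qed
  let ?L = "\<integral>\<nu>. exp (- \<alpha> \<nu> * D) * (\<alpha> \<nu> * B \<nu> 1) \<partial>freq"
  let ?G = "\<integral>p. \<alpha> (fst p) * g (fst p) (snd p) \<partial>ray_measure"
  have "0 < ?L"
  proof (rule integral_freq_pos[OF int_damped])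
    show "0 < exp (- \<alpha> \<nu> * D) * (\<alpha> \<nu> * B \<nu> 1)" if "\<nu> > 0" for \<nu>
    proof -
      have "0 < B \<nu> 1"
        using planck_less[OF constants that, of 0 1] planck_nonneg[OF constants that, of 0] by simp
      then show ?thesis using \<alpha>_pos[OF that] by simp
    qed
  qed simp
  then have \<sigma>L: "0 < ?\<sigma> * ?L" using sphere_surface_pos by simp
  \<comment> \<open>The damped emission at temperature 1 times \<open>m\<close> must exceed the absorbed boundary radiation.\<close>
  obtain m where m: "?G < real m * (?\<sigma> * ?L)"
    using reals_Archimedean3[OF \<sigma>L] by blast
  let ?C = "real (Suc m)"
  have C0: "0 \<le> ?C" by simp
  have damped_large: "real (Suc m) * ?L \<le> (\<integral>\<nu>. exp (- \<alpha> \<nu> * D) * (\<alpha> \<nu> * B \<nu> ?C) \<partial>freq)"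
  proof -
    have "real (Suc m) * ?L = (\<integral>\<nu>. real (Suc m) * (exp (- \<alpha> \<nu> * D) * (\<alpha> \<nu> * B \<nu> 1)) \<partial>freq)"
      by (simp del: of_nat_Suc)
    also have "\<dots> \<le> (\<integral>\<nu>. exp (- \<alpha> \<nu> * D) * (\<alpha> \<nu> * B \<nu> ?C) \<partial>freq)"
    proof (rule integral_mono)
      show "integrable freq (\<lambda>\<nu>. real (Suc m) * (exp (- \<alpha> \<nu> * D) * (\<alpha> \<nu> * B \<nu> 1)))"
        using int_damped[of 1] by (simp del: of_nat_Suc)
      show "integrable freq (\<lambda>\<nu>. exp (- \<alpha> \<nu> * D) * (\<alpha> \<nu> * B \<nu> ?C))" by (rule int_damped[OF C0])
      fix \<nu> :: real assume "\<nu> \<in> space freq"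
      then have \<nu>: "\<nu> > 0" by (simp add: space_restrict_space)
      have "exp (- \<alpha> \<nu> * D) * (\<alpha> \<nu> * (real (Suc m) * B \<nu> 1)) \<le> exp (- \<alpha> \<nu> * D) * (\<alpha> \<nu> * B \<nu> ?C)"
        using planck_superlinear[OF constants \<nu>, of "Suc m"] \<alpha>_pos[OF \<nu>] by (intro mult_left_mono) auto
      then show "real (Suc m) * (exp (- \<alpha> \<nu> * D) * (\<alpha> \<nu> * B \<nu> 1)) \<le> exp (- \<alpha> \<nu> * D) * (\<alpha> \<nu> * B \<nu> ?C)"
        by (simp only: mult_ac)
    qed
    finally show ?thesis .
  qed
  have G_le: "?G \<le> (\<integral>p. exp (- \<alpha> (fst p) * D) * (\<alpha> (fst p) * B (fst p) ?C) \<partial>ray_measure)"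
  proof -
    have "?G \<le> ?\<sigma> * (real (Suc m) * ?L)"
      using m \<sigma>L by (simp add: algebra_simps)
    also have "\<dots> \<le> ?\<sigma> * (\<integral>\<nu>. exp (- \<alpha> \<nu> * D) * (\<alpha> \<nu> * B \<nu> ?C) \<partial>freq)"
      using damped_large by (intro mult_left_mono) auto
    also have "\<dots> = (\<integral>p. exp (- \<alpha> (fst p) * D) * (\<alpha> (fst p) * B (fst p) ?C) \<partial>ray_measure)"
      by (rule integrable_freq_ray(2)[OF int_damped[OF C0], symmetric])
    finally show ?thesis .
  qed
  have "absorbed T x \<le> emission h c k \<alpha> ?C" if T: "bounded_temp ?C T" and x: "x \<in> \<Omega>" for T x
  proof -
    note int_ray = integrable_freq_ray(1)[OF integrable_\<alpha>_B[OF C0]] integrable_freq_ray(1)[OF int_damped[OF C0]]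
    have "(\<integral>p. \<alpha> (fst p) * field T p x \<partial>ray_measure)
        \<le> (\<integral>p. (\<alpha> (fst p) * B (fst p) ?C - exp (- \<alpha> (fst p) * D) * (\<alpha> (fst p) * B (fst p) ?C))
              + \<alpha> (fst p) * g (fst p) (snd p) \<partial>ray_measure)"
    proof (rule integral_mono)
      show "integrable ray_measure (\<lambda>p. \<alpha> (fst p) * field T p x)" by (rule integrable_field(2)[OF T])
      show "integrable ray_measure (\<lambda>p. (\<alpha> (fst p) * B (fst p) ?C - exp (- \<alpha> (fst p) * D) * (\<alpha> (fst p) * B (fst p) ?C))
              + \<alpha> (fst p) * g (fst p) (snd p))"
        by (intro Bochner_Integration.integrable_add Bochner_Integration.integrable_diff int_ray integrable_\<alpha>_g)
      fix p assume p: "p \<in> space ray_measure"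
      then have \<nu>: "fst p > 0" and n: "norm (snd p) = 1" and g0: "0 \<le> g (fst p) (snd p)"
        using g_nonneg by (auto simp: space_ray)
      note a = \<alpha>_pos[OF \<nu>]
      let ?BC = "B (fst p) ?C" and ?gp = "g (fst p) (snd p)"
      have BC: "0 \<le> ?BC" by (rule planck_nonneg[OF constants \<nu> C0])
      have "field T p x \<le> attenuate (\<alpha> (fst p)) (snd p) (\<lambda>z. ?BC * indicator \<Omega> z + ?gp) x"
        unfolding field_def
      proof (rule attenuate_mono[OF a borel_measurable_source[OF T p] source_bounds(3)[OF T p]])
        show "\<bar>?BC * indicator \<Omega> z + ?gp\<bar> \<le> ?BC + ?gp" for z
          using BC g0 by (auto simp: indicator_def)
        show "source T p z \<le> ?BC * indicator \<Omega> z + ?gp" for z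
          using planck_mono[OF constants \<nu>, of "T z" ?C] T g0 by (auto simp: source_def bounded_temp_def indicator_def intro: add_increasing2)
      qed measurable
      also have "\<dots> = ?BC * attenuate (\<alpha> (fst p)) (snd p) (indicator \<Omega>) x + ?gp"
      proof -
        have "\<bar>?BC * indicator \<Omega> z\<bar> \<le> ?BC" for z
          using BC by (simp add: indicator_def)
        then show ?thesis
          by (subst attenuate_add[OF a, where ?M1.0="?BC" and ?M2.0="\<bar>?gp\<bar>"]) (simp_all add: attenuate_cmult[OF a] attenuate_const[OF a])
      qed
      also have "\<dots> \<le> ?BC * (1 - exp (- \<alpha> (fst p) * D)) + ?gp"
        using BC D x n by (intro add_right_mono mult_left_mono attenuate_indicator_le a) auto
      finally have "\<alpha> (fst p) * field T p x \<le> \<alpha> (fst p) * (?BC * (1 - exp (- \<alpha> (fst p) * D)) + ?gp)"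
        using a by (intro mult_left_mono) auto
      then show "\<alpha> (fst p) * field T p x \<le> (\<alpha> (fst p) * ?BC - exp (- \<alpha> (fst p) * D) * (\<alpha> (fst p) * ?BC)) + \<alpha> (fst p) * ?gp"
        by (simp add: algebra_simps)
    qed
    also have "\<dots> = (\<integral>p. \<alpha> (fst p) * B (fst p) ?C \<partial>ray_measure)
        - (\<integral>p. exp (- \<alpha> (fst p) * D) * (\<alpha> (fst p) * B (fst p) ?C) \<partial>ray_measure) + ?G"
      by (simp only: Bochner_Integration.integral_add Bochner_Integration.integral_diff
          Bochner_Integration.integrable_diff int_ray integrable_\<alpha>_g)
    also have "\<dots> \<le> ?\<sigma> * emission h c k \<alpha> ?C"
      using G_le emission_eq[OF C0] by simp
    finally show ?thesis
      using sphere_surface_pos by (simp add: absorbed_def divide_le_eq mult.commute)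
  qed
  then show ?thesis using that[OF C0] by blast
qed

text \<open>
  Monotone iteration: starting from zero temperature, each step assigns to a point the temperature
  at which it emits what it absorbed from the previous field.  The iterates increase and stay
  below the constant supersolution, and both sides of the balance pass to the limit.
\<close>

lemma radiative_solution_exists:
  "\<exists>T. radiative_solution \<Omega> h c k \<alpha> g T \<and> Linf_nonneg \<Omega> (\<lambda>x. emission h c k \<alpha> (T x))"
proof -
  obtain C where C: "0 \<le> C" and super: "\<And>T x. bounded_temp C T \<Longrightarrow> x \<in> \<Omega> \<Longrightarrow> absorbed T x \<le> emission h c k \<alpha> C"
    by (rule constant_supersolution) blast
  define step where "step T x = (if x \<in> \<Omega> then temperature C (absorbed T x) else 0)" for T x
  define S where "S m = (step ^^ m) (\<lambda>_. 0)" for m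
  have S_Suc: "S (Suc m) = step (S m)" for m by (simp add: S_def)
  have bounded_step: "bounded_temp C (step T)" if T: "bounded_temp C T" for T
  proof -
    have [measurable]: "temperature C \<in> borel_measurable borel"
      by (rule borel_measurable_mono[OF mono_temperature[OF C]])
    note [measurable] = measurable_absorbed[OF T]
    have "step T \<in> borel_measurable borel" unfolding step_def[abs_def] by measurable
    then show ?thesis
      using C temperature_bounds[OF C] by (simp add: bounded_temp_def step_def)
  qed
  have bounded_S: "bounded_temp C (S m)" for m
    by (induction m) (use C bounded_step in \<open>auto simp: S_Suc\<close>, simp add: S_def bounded_temp_def)
  have S_mono: "S m x \<le> S (Suc m) x" for m x
  proof (induction m arbitrary: x)
    case 0
    show ?case using bounded_S[of "Suc 0"] by (simp add: S_def bounded_temp_def)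
  next
    case (Suc m)
    have "absorbed (S m) x \<le> absorbed (S (Suc m)) x"
      by (rule absorbed_mono[OF bounded_S bounded_S Suc.IH])
    then have "step (S m) x \<le> step (S (Suc m)) x"
      using monoD[OF mono_temperature[OF C]] by (simp add: step_def)
    then show ?case by (simp only: S_Suc)
  qed
  define T where "T x = (SUP m. S m x)" for x
  have T_lim: "(\<lambda>m. S m x) \<longlonglongrightarrow> T x" for x
    unfolding T_def
  proof (rule LIMSEQ_incseq_SUP)
    show "bdd_above (range (\<lambda>m. S m x))"
      using bounded_S by (intro bdd_aboveI[of _ C]) (auto simp: bounded_temp_def)
    show "incseq (\<lambda>m. S m x)" by (rule incseq_SucI) (rule S_mono)
  qed
  have T: "bounded_temp C T"
    unfolding bounded_temp_def
  proof (intro conjI allI)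
    show "T \<in> borel_measurable borel"
      by (rule borel_measurable_LIMSEQ_real[OF T_lim]) (use bounded_S in \<open>auto simp: bounded_temp_def\<close>)
    show "0 \<le> T x" "T x \<le> C" for x
      using bounded_S by (auto simp: bounded_temp_def intro!: LIMSEQ_le_const[OF T_lim] LIMSEQ_le_const2[OF T_lim])
  qed
  have fixed: "emission h c k \<alpha> (T x) = absorbed T x" if x: "x \<in> \<Omega>" for x
  proof (rule LIMSEQ_unique)
    show "(\<lambda>m. emission h c k \<alpha> (S (Suc m) x)) \<longlonglongrightarrow> emission h c k \<alpha> (T x)"
      by (rule emission_tendsto[where C=C]) (use bounded_S LIMSEQ_Suc[OF T_lim] in \<open>auto simp: bounded_temp_def\<close>)
    have "emission h c k \<alpha> (S (Suc m) x) = absorbed (S m) x" for m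
      using x absorbed_nonneg[OF bounded_S] super[OF bounded_S x]
      by (simp add: S_Suc step_def emission_temperature[OF C])
    then show "(\<lambda>m. emission h c k \<alpha> (S (Suc m) x)) \<longlonglongrightarrow> absorbed T x"
      using absorbed_tendsto[OF bounded_S T T_lim] by simp
  qed
  have "exchange T x = 0" if "x \<in> \<Omega>" for x
    using exchange_eq[OF T that] fixed[OF that] sphere_surface_pos by (simp add: absorbed_def)
  then have "radiative_solution \<Omega> h c k \<alpha> g T"
    by (rule radiative_solution_of_exchange_zero[OF T])
  moreover have "Linf_nonneg \<Omega> (\<lambda>x. emission h c k \<alpha> (T x))"
    unfolding Linf_nonneg_def
  proof (intro conjI exI[of _ "emission h c k \<alpha> C"] AE_I2 impI)
    have "(\<lambda>x. emission h c k \<alpha> (T x)) \<in> borel_measurable (restrict_space borel \<Omega>)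
        \<longleftrightarrow> absorbed T \<in> borel_measurable (restrict_space borel \<Omega>)"
      using fixed by (intro measurable_cong) (simp add: space_restrict_space)
    then show "(\<lambda>x. emission h c k \<alpha> (T x)) \<in> borel_measurable (restrict_space borel \<Omega>)"
      using measurable_absorbed[OF T] by (simp add: measurable_restrict_space1)
    show "0 \<le> emission h c k \<alpha> (T x)" "emission h c k \<alpha> (T x) \<le> emission h c k \<alpha> C" for x
      using T emission_mono[of 0 "T x"] emission_mono[of "T x" C] by (auto simp: emission_0 bounded_temp_def)
  qed
  ultimately show ?thesis by blast
qed

end

theorem theorem3p2:
  fixes \<Omega> :: "(real ^ 3) set"
    and h c k :: real
    and \<alpha> :: "real \<Rightarrow> real"
    and g :: "real \<Rightarrow> real ^ 3 \<Rightarrow> real"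
  assumes "h > 0" "c > 0" "k > 0"
    and "open \<Omega>" "connected \<Omega>" "\<Omega> \<noteq> {}" "bounded \<Omega>" "convex \<Omega>" "C1_boundary \<Omega>"
    and "\<And>\<nu>. \<nu> > 0 \<Longrightarrow> \<alpha> \<nu> > 0"
    and "integrable freq \<alpha>"
    and "\<And>\<nu> n. \<nu> > 0 \<Longrightarrow> n \<in> sphere 0 1 \<Longrightarrow> g \<nu> n \<ge> 0"
    and "integrable (freq \<Otimes>\<^sub>M sphere_surface) (\<lambda>(\<nu>, n). g \<nu> n)"
    and "integrable (freq \<Otimes>\<^sub>M sphere_surface) (\<lambda>(\<nu>, n). (\<alpha> \<nu>)\<^sup>2 * g \<nu> n)"
  shows "(\<exists>T. radiative_solution \<Omega> h c k \<alpha> g T \<and>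
              Linf_nonneg \<Omega> (\<lambda>x. emission h c k \<alpha> (T x))) \<and>
         (\<forall>T1 T2. radiative_solution \<Omega> h c k \<alpha> g T1 \<and>
                  Linf_nonneg \<Omega> (\<lambda>x. emission h c k \<alpha> (T1 x)) \<and>
                  radiative_solution \<Omega> h c k \<alpha> g T2 \<and>
                  Linf_nonneg \<Omega> (\<lambda>x. emission h c k \<alpha> (T2 x)) \<longrightarrow>
                  (AE x\<in>\<Omega> in lborel.
                     emission h c k \<alpha> (T1 x) = emission h c k \<alpha> (T2 x)))"
proof -
  interpret medium \<Omega> h c k \<alpha> g
    by unfold_locales (use assms in auto)
  show ?thesis
    using radiative_solution_exists radiative_solution_unique by blast
qed

end
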